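(* Let $X$ be a projective variety over a non-Archimedean field $\mathfrak{K}$ and $L$ an ample line bundle on $X$. Let $\zeta^0_\bullet=(\zeta^0_k)_k$ and $\zeta^1_\bullet=(\zeta^1_k)_k$ be two bounded graded norms on the section ring $R(X,L)=\bigoplus_{k\ge0}H^0(kL)$. For each $k$ and $t\in[0,1]$ let $\zeta^t_k$ be the point at time $t$ of the norm geodesic joining $\zeta^0_k$ and $\zeta^1_k$ in the space of norms on $H^0(kL)$. Then for all $t\in[0,1]$ the sequence of norms $\zeta^t_\bullet=(\zeta^t_k)_k$ is submultiplicative: for all $k,\ell$, all $s_k\in H^0(kL)$ and all $s_\ell\in H^0(\ell L)$, $$\zeta^t_{k+\ell}(s_k\cdot s_\ell)\le\zeta^t_k(s_k)\cdot\zeta^t_\ell(s_\ell).$$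
   Context: **Setting.** $\mathfrak{K}$ is a field complete with respect to a non-Archimedean absolute value $|\cdot|$ (possibly trivial), and $X$ is a geometrically integral projective $\mathfrak{K}$-scheme. All norms are ultrametric norms on finite-dimensional $\mathfrak{K}$-vector spaces: $\zeta(v+w)\le\max\{\zeta(v),\zeta(w)\}$ and $\zeta(av)=|a|\zeta(v)$. Write $kL=L^{\otimes k}$. **Norm geodesics.** A norm $\zeta$ on $V$ is diagonalized by a basis $(s_i)$ if $\zeta(\sum a_is_i)=\max_i|a_i|\zeta(s_i)$ for all $a_i\in\mathfrak{K}$; it is diagonalizable if such a basis exists. Any two diagonalizable norms $\zeta_0,\zeta_1$ are diagonalized by a common basis $(s_i)$, and the norm geodesic joining them is $t\mapsto\zeta_t$, where $\zeta_t$ is the norm diagonalized by $(s_i)$ with $\zeta_t(s_i)=\zeta_0(s_i)^{1-t}\zeta_1(s_i)^t$. For general norms $\zeta_0,\zeta_1$, the norm geodesic is $\zeta_t=\lim_n\zeta_t^n$ (pointwise limit on $V$), where $\zeta_i^n$ ($i=0,1$) are diagonalizable norms with $\sup_{v\ne0}\left|\log\frac{\zeta_i^n(v)}{\zeta_i(v)}\right|\to0$ and $\zeta_t^n$ is the norm geodesic joining $\zeta_0^n,\zeta_1^n$; such approximations exist, the limit exists, and it is independent of the approximations. **Bounded graded norms.** A graded norm on $R(X,L)$ is a sequence of norms $\zeta_k$ on $H^0(kL)$ with $\zeta_{k+\ell}(s_k\cdot s_\ell)\le\zeta_k(s_k)\zeta_\ell(s_\ell)$. Given $r\ge1$ such that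 all multiplication maps $H^0(rL)^{\odot m}\to H^0(rmL)$ ($m\ge1$) are surjective and a norm $\zeta'$ on $H^0(rL)$, let $\zeta'_m$ be the norm induced on $H^0(rmL)$ as a quotient norm of the symmetric power norm $\zeta'^{\odot m}$. Here $\zeta'^{\odot m}$ is the quotient of the tensor norm $\zeta'^{\otimes m}(v)=\inf\max_i\zeta'(v^i_1)\cdots\zeta'(v^i_m)$, the infimum being over finite decompositions $v=\sum_iv^i_1\otimes\cdots\otimes v^i_m$; the quotient norm on $V/W$ is $[v]\mapsto\inf_{w\in W}\zeta(v+w)$. A graded norm $\zeta_\bullet$ is bounded if there exist such $r,\zeta'$ and $C>0$ with $e^{-rmC}\zeta'_m\le\zeta_{rm}\le e^{rmC}\zeta'_m$ for all $m$. *)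

theory Defs
  imports
    "HOL-Analysis.Analysis"
    "HOL-Algebra.Algebra"
    "HOL-Algebra.Algebraic_Closure_Type"
    "HOL-Library.Poly_Mapping"
begin

section \<open>Non-Archimedean fields\<close>

text \<open>The field is a type \<open>'k\<close> of class \<open>field\<close>; the absolute value is a parameter and may be
  trivial. As a HOL-Algebra ring the field is \<open>ring_of_type_algebra\<close>.\<close>

definition nonarch_abs :: "('k::field \<Rightarrow> real) \<Rightarrow> bool" where
  "nonarch_abs av \<longleftrightarrow>
     (\<forall>a. 0 \<le> av a) \<and> (\<forall>a. av a = 0 \<longleftrightarrow> a = 0) \<and>
     (\<forall>a b. av (a * b) = av a * av b) \<and> (\<forall>a b. av (a + b) \<le> max (av a) (av b))"

definition complete_nonarch_abs :: "('k::field \<Rightarrow> real) \<Rightarrow> bool" where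
  "complete_nonarch_abs av \<longleftrightarrow>
     nonarch_abs av \<and> Metric_space.mcomplete UNIV (\<lambda>a b. av (a - b))"

section \<open>Norms and norm geodesics\<close>

definition norm_on :: "('k::field \<Rightarrow> real) \<Rightarrow> ('k, 'v) module \<Rightarrow> ('v \<Rightarrow> real) \<Rightarrow> bool" where
  "norm_on av V \<zeta> \<longleftrightarrow>
     (\<forall>v\<in>carrier V. 0 \<le> \<zeta> v \<and> (\<zeta> v = 0 \<longleftrightarrow> v = \<zero>\<^bsub>V\<^esub>)) \<and>
     (\<forall>a. \<forall>v\<in>carrier V. \<zeta> (a \<odot>\<^bsub>V\<^esub> v) = av a * \<zeta> v) \<and>
     (\<forall>v\<in>carrier V. \<forall>w\<in>carrier V. \<zeta> (v \<oplus>\<^bsub>V\<^esub> w) \<le> max (\<zeta> v) (\<zeta> w))"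

definition lincomb :: "('k, 'v) module \<Rightarrow> nat \<Rightarrow> (nat \<Rightarrow> 'v) \<Rightarrow> (nat \<Rightarrow> 'k) \<Rightarrow> 'v" where
  "lincomb V n s a = (\<Oplus>\<^bsub>V\<^esub>i\<in>{..<n}. a i \<odot>\<^bsub>V\<^esub> s i)"

definition is_basis :: "('k, 'v) module \<Rightarrow> nat \<Rightarrow> (nat \<Rightarrow> 'v) \<Rightarrow> bool" where
  "is_basis V n s \<longleftrightarrow>
     s \<in> {..<n} \<rightarrow> carrier V \<and>
     (\<forall>v\<in>carrier V. \<exists>!a. a \<in> {..<n} \<rightarrow>\<^sub>E UNIV \<and> v = lincomb V n s a)"

text \<open>The extra element 0 of the maximum only matters for the zero space, where \<open>n = 0\<close>.\<close>

definition diagonalized_by ::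
  "('k::field \<Rightarrow> real) \<Rightarrow> ('k, 'v) module \<Rightarrow> ('v \<Rightarrow> real) \<Rightarrow> nat \<Rightarrow> (nat \<Rightarrow> 'v) \<Rightarrow> bool" where
  "diagonalized_by av V \<zeta> n s \<longleftrightarrow>
     is_basis V n s \<and>
     (\<forall>a. \<zeta> (lincomb V n s a) = Max (insert 0 ((\<lambda>i. av (a i) * \<zeta> (s i)) ` {..<n})))"

definition diagonalizable ::
  "('k::field \<Rightarrow> real) \<Rightarrow> ('k, 'v) module \<Rightarrow> ('v \<Rightarrow> real) \<Rightarrow> bool" where
  "diagonalizable av V \<zeta> \<longleftrightarrow> norm_on av V \<zeta> \<and> (\<exists>n s. diagonalized_by av V \<zeta> n s)"

definition diag_geodesic_at ::
  "('k::field \<Rightarrow> real) \<Rightarrow> ('k, 'v) module \<Rightarrow> ('v \<Rightarrow> real) \<Rightarrow> ('v \<Rightarrow> real) \<Rightarrow> real \<Rightarrow>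
    ('v \<Rightarrow> real) \<Rightarrow> bool" where
  "diag_geodesic_at av V \<zeta>0 \<zeta>1 t \<zeta> \<longleftrightarrow>
     (\<exists>n s. diagonalized_by av V \<zeta>0 n s \<and> diagonalized_by av V \<zeta>1 n s \<and>
        diagonalized_by av V \<zeta> n s \<and>
        (\<forall>i<n. \<zeta> (s i) = \<zeta>0 (s i) powr (1 - t) * \<zeta>1 (s i) powr t))"

text \<open>\<open>norm_approx av V Z \<zeta>\<close>: the norms \<open>Z n\<close> are diagonalizable and
  \<open>sup |log (Z n v / \<zeta> v)| \<longrightarrow> 0\<close>, the supremum being over nonzero \<open>v\<close>.\<close>

definition norm_approx ::
  "('k::field \<Rightarrow> real) \<Rightarrow> ('k, 'v) module \<Rightarrow> (nat \<Rightarrow> 'v \<Rightarrow> real) \<Rightarrow> ('v \<Rightarrow> real) \<Rightarrow> bool" where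
  "norm_approx av V Z \<zeta> \<longleftrightarrow>
     (\<forall>n. diagonalizable av V (Z n)) \<and>
     uniform_limit (carrier V - {\<zero>\<^bsub>V\<^esub>}) (\<lambda>n v. ln (Z n v / \<zeta> v)) (\<lambda>v. 0) sequentially"

text \<open>\<open>\<zeta>\<close> is the point at time \<open>t\<close> of the norm geodesic joining \<open>\<zeta>0\<close> and \<open>\<zeta>1\<close>.\<close>

definition norm_geodesic_at ::
  "('k::field \<Rightarrow> real) \<Rightarrow> ('k, 'v) module \<Rightarrow> ('v \<Rightarrow> real) \<Rightarrow> ('v \<Rightarrow> real) \<Rightarrow> real \<Rightarrow>
    ('v \<Rightarrow> real) \<Rightarrow> bool" where
  "norm_geodesic_at av V \<zeta>0 \<zeta>1 t \<zeta> \<longleftrightarrow>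
     (\<exists>Z0 Z1 Zt. norm_approx av V Z0 \<zeta>0 \<and> norm_approx av V Z1 \<zeta>1 \<and>
        (\<forall>n. diag_geodesic_at av V (Z0 n) (Z1 n) t (Zt n)) \<and>
        (\<forall>v\<in>carrier V. (\<lambda>n. Zt n v) \<longlonglongrightarrow> \<zeta> v))"

section \<open>Tensor and symmetric powers of modules\<close>

text \<open>A formal tensor is a list of terms \<open>(a, [x\<^sub>1, \<dots>, x\<^sub>k])\<close>, read as the sum of the
  \<open>a x\<^sub>1 \<otimes> \<dots> \<otimes> x\<^sub>k\<close>. The \<open>k\<close>-th tensor power is the set of formal tensors modulo the
  congruence generated by multilinearity; for \<open>k = 0\<close> it is the ring itself.\<close>

type_synonym ('r, 'm) ftensor = "('r \<times> 'm list) list"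

definition ftensors ::
  "('r, 'z) ring_scheme \<Rightarrow> ('r, 'm) module \<Rightarrow> nat \<Rightarrow> ('r, 'm) ftensor set" where
  "ftensors A M k = lists (carrier A \<times> {xs. length xs = k \<and> set xs \<subseteq> carrier M})"

inductive tensor_eq ::
  "('r, 'z) ring_scheme \<Rightarrow> ('r, 'm) module \<Rightarrow> nat \<Rightarrow> ('r, 'm) ftensor \<Rightarrow> ('r, 'm) ftensor \<Rightarrow> bool"
  for A :: "('r, 'z) ring_scheme" and M :: "('r, 'm) module" and k :: nat where
  refl: "u \<in> ftensors A M k \<Longrightarrow> tensor_eq A M k u u"
| sym: "tensor_eq A M k u v \<Longrightarrow> tensor_eq A M k v u"
| trans: "tensor_eq A M k u v \<Longrightarrow> tensor_eq A M k v w \<Longrightarrow> tensor_eq A M k u w"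
| append: "tensor_eq A M k u u' \<Longrightarrow> tensor_eq A M k v v' \<Longrightarrow> tensor_eq A M k (u @ v) (u' @ v')"
| commute: "u \<in> ftensors A M k \<Longrightarrow> v \<in> ftensors A M k \<Longrightarrow> tensor_eq A M k (u @ v) (v @ u)"
| zero_coeff: "[(\<zero>\<^bsub>A\<^esub>, xs)] \<in> ftensors A M k \<Longrightarrow> tensor_eq A M k [(\<zero>\<^bsub>A\<^esub>, xs)] []"
| add_coeff: "[(a, xs), (b, xs)] \<in> ftensors A M k \<Longrightarrow>
    tensor_eq A M k [(a \<oplus>\<^bsub>A\<^esub> b, xs)] [(a, xs), (b, xs)]"
| add_slot: "[(a, xs @ x # ys), (a, xs @ y # ys)] \<in> ftensors A M k \<Longrightarrow>
    tensor_eq A M k [(a, xs @ (x \<oplus>\<^bsub>M\<^esub> y) # ys)] [(a, xs @ x # ys), (a, xs @ y # ys)]"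
| smult_slot: "[(a, xs @ x # ys)] \<in> ftensors A M k \<Longrightarrow> b \<in> carrier A \<Longrightarrow>
    tensor_eq A M k [(a, xs @ (b \<odot>\<^bsub>M\<^esub> x) # ys)] [(a \<otimes>\<^bsub>A\<^esub> b, xs @ x # ys)]"

inductive sym_eq ::
  "('r, 'z) ring_scheme \<Rightarrow> ('r, 'm) module \<Rightarrow> nat \<Rightarrow> ('r, 'm) ftensor \<Rightarrow> ('r, 'm) ftensor \<Rightarrow> bool"
  for A :: "('r, 'z) ring_scheme" and M :: "('r, 'm) module" and k :: nat where
  tensor: "tensor_eq A M k u v \<Longrightarrow> sym_eq A M k u v"
| trans: "sym_eq A M k u v \<Longrightarrow> sym_eq A M k v w \<Longrightarrow> sym_eq A M k u w"
| append: "sym_eq A M k u u' \<Longrightarrow> sym_eq A M k v v' \<Longrightarrow> sym_eq A M k (u @ v) (u' @ v')"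
| permute: "[(a, xs)] \<in> ftensors A M k \<Longrightarrow> mset xs = mset ys \<Longrightarrow> sym_eq A M k [(a, xs)] [(a, ys)]"

definition tensor_class ::
  "('r, 'z) ring_scheme \<Rightarrow> ('r, 'm) module \<Rightarrow> nat \<Rightarrow> ('r, 'm) ftensor \<Rightarrow> ('r, 'm) ftensor set" where
  "tensor_class A M k u = {v. tensor_eq A M k u v}"

definition sym_class ::
  "('r, 'z) ring_scheme \<Rightarrow> ('r, 'm) module \<Rightarrow> nat \<Rightarrow> ('r, 'm) ftensor \<Rightarrow> ('r, 'm) ftensor set" where
  "sym_class A M k u = {v. sym_eq A M k u v}"

text \<open>The operations on classes below are unions over representatives, each representative giving
  the same class. The fields \<open>mult\<close> and \<open>one\<close> of a module record carry no information.\<close>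

definition tensor_power ::
  "('r, 'z) ring_scheme \<Rightarrow> ('r, 'm) module \<Rightarrow> nat \<Rightarrow> ('r, ('r, 'm) ftensor set) module" where
  "tensor_power A M k =
     \<lparr>carrier = tensor_class A M k ` ftensors A M k,
      monoid.mult = (\<lambda>_ _. undefined), one = undefined,
      ring.zero = tensor_class A M k [],
      ring.add = (\<lambda>c d. \<Union>u\<in>c. \<Union>v\<in>d. tensor_class A M k (u @ v)),
      smult = (\<lambda>a c. \<Union>u\<in>c. tensor_class A M k (map (\<lambda>(b, xs). (a \<otimes>\<^bsub>A\<^esub> b, xs)) u))\<rparr>"

definition ftensor_mult ::
  "('r, 'z) ring_scheme \<Rightarrow> ('r, 'm) ftensor \<Rightarrow> ('r, 'm) ftensor \<Rightarrow> ('r, 'm) ftensor" where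
  "ftensor_mult A u v = [(a \<otimes>\<^bsub>A\<^esub> b, xs @ ys). (a, xs) \<leftarrow> u, (b, ys) \<leftarrow> v]"

definition tensor_mult ::
  "('r, 'z) ring_scheme \<Rightarrow> ('r, 'm) module \<Rightarrow> nat \<Rightarrow> nat \<Rightarrow>
    ('r, 'm) ftensor set \<Rightarrow> ('r, 'm) ftensor set \<Rightarrow> ('r, 'm) ftensor set" where
  "tensor_mult A M k l c d = (\<Union>u\<in>c. \<Union>v\<in>d. tensor_class A M (k + l) (ftensor_mult A u v))"

section \<open>Ringed spaces and sheaves of modules\<close>

definition is_sheaf ::
  "'x topology \<Rightarrow> ('x set \<Rightarrow> 's set) \<Rightarrow> ('x set \<Rightarrow> 'x set \<Rightarrow> 's \<Rightarrow> 's) \<Rightarrow> bool" where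
  "is_sheaf T F r \<longleftrightarrow>
     (\<forall>U V. openin T U \<and> openin T V \<and> V \<subseteq> U \<longrightarrow> r U V \<in> F U \<rightarrow> F V) \<and>
     (\<forall>U. openin T U \<longrightarrow> (\<forall>s\<in>F U. r U U s = s)) \<and>
     (\<forall>U V W. openin T U \<and> openin T V \<and> openin T W \<and> W \<subseteq> V \<and> V \<subseteq> U \<longrightarrow>
        (\<forall>s\<in>F U. r V W (r U V s) = r U W s)) \<and>
     (\<forall>\<U> s. (\<forall>U\<in>\<U>. openin T U) \<and> (\<forall>U\<in>\<U>. s U \<in> F U) \<and>
        (\<forall>U\<in>\<U>. \<forall>V\<in>\<U>. r U (U \<inter> V) (s U) = r V (U \<inter> V) (s V)) \<longrightarrow>
        (\<exists>!t. t \<in> F (\<Union>\<U>) \<and> (\<forall>U\<in>\<U>. r (\<Union>\<U>) U t = s U)))"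

record ('x, 'r) rspace =
  utop :: "'x topology"
  sec :: "'x set \<Rightarrow> 'r ring"
  res :: "'x set \<Rightarrow> 'x set \<Rightarrow> 'r \<Rightarrow> 'r"

definition ringed_space :: "('x, 'r, 'z) rspace_scheme \<Rightarrow> bool" where
  "ringed_space S \<longleftrightarrow>
     (\<forall>U. openin (utop S) U \<longrightarrow> cring (sec S U)) \<and>
     (\<forall>U V. openin (utop S) U \<and> openin (utop S) V \<and> V \<subseteq> U \<longrightarrow>
        res S U V \<in> ring_hom (sec S U) (sec S V)) \<and>
     is_sheaf (utop S) (\<lambda>U. carrier (sec S U)) (res S)"

text \<open>A ringed space over the field \<open>'k\<close>: \<open>str\<close> is the structure map from \<open>'k\<close> to the ring of
  global sections.\<close>

record ('x, 'r, 'k) kspace = "('x, 'r) rspace" + str :: "'k \<Rightarrow> 'r"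

definition ringed_kspace :: "('x, 'r, 'k::field) kspace \<Rightarrow> bool" where
  "ringed_kspace S \<longleftrightarrow>
     ringed_space S \<and> str S \<in> ring_hom ring_of_type_algebra (sec S (topspace (utop S)))"

definition rspace_iso ::
  "('x, 'r, 'z) rspace_scheme \<Rightarrow> ('y, 's, 'w) rspace_scheme \<Rightarrow> ('x \<Rightarrow> 'y) \<Rightarrow>
    ('x set \<Rightarrow> 'r \<Rightarrow> 's) \<Rightarrow> bool" where
  "rspace_iso S Y f \<phi> \<longleftrightarrow>
     homeomorphic_map (utop S) (utop Y) f \<and>
     (\<forall>U. openin (utop S) U \<longrightarrow> \<phi> U \<in> ring_iso (sec S U) (sec Y (f ` U))) \<and>
     (\<forall>U V. openin (utop S) U \<and> openin (utop S) V \<and> V \<subseteq> U \<longrightarrow>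
        (\<forall>s\<in>carrier (sec S U). \<phi> V (res S U V s) = res Y (f ` U) (f ` V) (\<phi> U s)))"

definition rspace_isomorphic ::
  "('x, 'r, 'z) rspace_scheme \<Rightarrow> ('y, 's, 'w) rspace_scheme \<Rightarrow> bool" where
  "rspace_isomorphic S Y \<longleftrightarrow> (\<exists>f \<phi>. rspace_iso S Y f \<phi>)"

definition kspace_isomorphic :: "('x, 'r, 'k) kspace \<Rightarrow> ('y, 's, 'k) kspace \<Rightarrow> bool" where
  "kspace_isomorphic S Y \<longleftrightarrow>
     (\<exists>f \<phi>. rspace_iso S Y f \<phi> \<and> (\<forall>a. \<phi> (topspace (utop S)) (str S a) = str Y a))"

definition open_subspace :: "('x, 'r, 'z) rspace_scheme \<Rightarrow> 'x set \<Rightarrow> ('x, 'r) rspace" where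
  "open_subspace S U = \<lparr>utop = subtopology (utop S) U, sec = sec S, res = res S\<rparr>"

definition integral_rspace :: "('x, 'r, 'z) rspace_scheme \<Rightarrow> bool" where
  "integral_rspace S \<longleftrightarrow>
     topspace (utop S) \<noteq> {} \<and> (\<forall>U. openin (utop S) U \<and> U \<noteq> {} \<longrightarrow> domain (sec S U))"

text \<open>The germ at \<open>x\<close> of a section \<open>s\<close> over \<open>U\<close>, as an equivalence class of pairs.\<close>

definition germ ::
  "'x topology \<Rightarrow> ('x set \<Rightarrow> 's set) \<Rightarrow> ('x set \<Rightarrow> 'x set \<Rightarrow> 's \<Rightarrow> 's) \<Rightarrow> 'x \<Rightarrow>
    'x set \<Rightarrow> 's \<Rightarrow> ('x set \<times> 's) set" where
  "germ T F r x U s =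
     {(V, t). openin T V \<and> x \<in> V \<and> t \<in> F V \<and>
        (\<exists>W. openin T W \<and> x \<in> W \<and> W \<subseteq> U \<inter> V \<and> r U W s = r V W t)}"

definition rgerm ::
  "('x, 'r, 'z) rspace_scheme \<Rightarrow> 'x \<Rightarrow> 'x set \<Rightarrow> 'r \<Rightarrow> ('x set \<times> 'r) set" where
  "rgerm S = germ (utop S) (\<lambda>U. carrier (sec S U)) (res S)"

definition stalk :: "('x, 'r, 'z) rspace_scheme \<Rightarrow> 'x \<Rightarrow> ('x set \<times> 'r) set ring" where
  "stalk S x =
     \<lparr>carrier = {rgerm S x U s | U s. openin (utop S) U \<and> x \<in> U \<and> s \<in> carrier (sec S U)},
      monoid.mult = (\<lambda>g h. \<Union>(U, s)\<in>g. \<Union>(V, t)\<in>h.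
        rgerm S x (U \<inter> V) (res S U (U \<inter> V) s \<otimes>\<^bsub>sec S (U \<inter> V)\<^esub> res S V (U \<inter> V) t)),
      one = rgerm S x (topspace (utop S)) \<one>\<^bsub>sec S (topspace (utop S))\<^esub>,
      ring.zero = rgerm S x (topspace (utop S)) \<zero>\<^bsub>sec S (topspace (utop S))\<^esub>,
      ring.add = (\<lambda>g h. \<Union>(U, s)\<in>g. \<Union>(V, t)\<in>h.
        rgerm S x (U \<inter> V) (res S U (U \<inter> V) s \<oplus>\<^bsub>sec S (U \<inter> V)\<^esub> res S V (U \<inter> V) t))\<rparr>"

record ('x, 'r, 'm) modsheaf =
  msec :: "'x set \<Rightarrow> ('r, 'm) module"
  mres :: "'x set \<Rightarrow> 'x set \<Rightarrow> 'm \<Rightarrow> 'm"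

definition sheaf_of_modules ::
  "('x, 'r, 'z) rspace_scheme \<Rightarrow> ('x, 'r, 'm) modsheaf \<Rightarrow> bool" where
  "sheaf_of_modules S L \<longleftrightarrow>
     (\<forall>U. openin (utop S) U \<longrightarrow> module (sec S U) (msec L U)) \<and>
     (\<forall>U V. openin (utop S) U \<and> openin (utop S) V \<and> V \<subseteq> U \<longrightarrow>
        (\<forall>s\<in>carrier (msec L U). \<forall>t\<in>carrier (msec L U).
           mres L U V (s \<oplus>\<^bsub>msec L U\<^esub> t) = mres L U V s \<oplus>\<^bsub>msec L V\<^esub> mres L U V t) \<and>
        (\<forall>a\<in>carrier (sec S U). \<forall>s\<in>carrier (msec L U).
           mres L U V (a \<odot>\<^bsub>msec L U\<^esub> s) = res S U V a \<odot>\<^bsub>msec L V\<^esub> mres L U V s)) \<and>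
     is_sheaf (utop S) (\<lambda>U. carrier (msec L U)) (mres L)"

text \<open>A line bundle is an invertible sheaf: it is locally isomorphic to the structure sheaf, an
  isomorphism over \<open>U\<close> being multiplication by the image \<open>e\<close> of 1.\<close>

definition line_bundle :: "('x, 'r, 'z) rspace_scheme \<Rightarrow> ('x, 'r, 'm) modsheaf \<Rightarrow> bool" where
  "line_bundle S L \<longleftrightarrow>
     sheaf_of_modules S L \<and>
     (\<forall>x\<in>topspace (utop S). \<exists>U e. openin (utop S) U \<and> x \<in> U \<and> e \<in> carrier (msec L U) \<and>
        (\<forall>V. openin (utop S) V \<and> V \<subseteq> U \<longrightarrow>
           bij_betw (\<lambda>a. a \<odot>\<^bsub>msec L V\<^esub> mres L U V e) (carrier (sec S V)) (carrier (msec L V))))"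

definition mgerm ::
  "('x, 'r, 'z) rspace_scheme \<Rightarrow> ('x, 'r, 'm) modsheaf \<Rightarrow> 'x \<Rightarrow> 'x set \<Rightarrow> 'm \<Rightarrow>
    ('x set \<times> 'm) set" where
  "mgerm S L = germ (utop S) (\<lambda>U. carrier (msec L U)) (mres L)"

definition mstalk ::
  "('x, 'r, 'z) rspace_scheme \<Rightarrow> ('x, 'r, 'm) modsheaf \<Rightarrow> 'x \<Rightarrow>
    (('x set \<times> 'r) set, ('x set \<times> 'm) set) module" where
  "mstalk S L x =
     \<lparr>carrier = {mgerm S L x U s | U s. openin (utop S) U \<and> x \<in> U \<and> s \<in> carrier (msec L U)},
      monoid.mult = (\<lambda>_ _. undefined), one = undefined,
      ring.zero = mgerm S L x (topspace (utop S)) \<zero>\<^bsub>msec L (topspace (utop S))\<^esub>,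
      ring.add = (\<lambda>g h. \<Union>(U, s)\<in>g. \<Union>(V, t)\<in>h.
        mgerm S L x (U \<inter> V) (mres L U (U \<inter> V) s \<oplus>\<^bsub>msec L (U \<inter> V)\<^esub> mres L V (U \<inter> V) t)),
      smult = (\<lambda>g h. \<Union>(U, a)\<in>g. \<Union>(V, t)\<in>h.
        mgerm S L x (U \<inter> V) (res S U (U \<inter> V) a \<odot>\<^bsub>msec L (U \<inter> V)\<^esub> mres L V (U \<inter> V) t))\<rparr>"

section \<open>Fraction sheaves, Spec and Proj\<close>

text \<open>A common construction for Spec and Proj. \<open>A\<close> is a ring, \<open>I\<close> an ideal, \<open>pts\<close> a set of prime
  ideals of \<open>A\<close> containing \<open>I\<close>, and \<open>D\<close> a set of admissible pairs (numerator, denominator).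
  The class of \<open>(a, f)\<close> at \<open>P\<close> is the fraction \<open>a / f\<close> in the localization of \<open>A / I\<close> at \<open>P / I\<close>,
  represented by the admissible pairs with denominator not in \<open>P\<close>.
  A section over \<open>U\<close> is a function that is locally given by a fraction.\<close>

definition fraction ::
  "'a ring \<Rightarrow> 'a set \<Rightarrow> ('a \<times> 'a) set \<Rightarrow> 'a set \<Rightarrow> 'a \<Rightarrow> 'a \<Rightarrow> ('a \<times> 'a) set" where
  "fraction A I D P a f =
     {(b, g). (b, g) \<in> D \<and> g \<notin> P \<and>
        (\<exists>h\<in>carrier A - P. h \<otimes>\<^bsub>A\<^esub> (a \<otimes>\<^bsub>A\<^esub> g \<ominus>\<^bsub>A\<^esub> b \<otimes>\<^bsub>A\<^esub> f) \<in> I)}"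

definition zariski :: "'a ring \<Rightarrow> 'a set set \<Rightarrow> 'a set topology" where
  "zariski A pts = topology_generated_by ((\<lambda>f. {P \<in> pts. f \<notin> P}) ` carrier A)"

definition frac_sections ::
  "'a ring \<Rightarrow> 'a set \<Rightarrow> ('a \<times> 'a) set \<Rightarrow> 'a set set \<Rightarrow> 'a set set \<Rightarrow>
    ('a set \<Rightarrow> ('a \<times> 'a) set) set" where
  "frac_sections A I D pts U =
     {s \<in> extensional U. \<forall>P\<in>U. \<exists>V a f. openin (zariski A pts) V \<and> P \<in> V \<and> V \<subseteq> U \<and> (a, f) \<in> D \<and>
        (\<forall>Q\<in>V. f \<notin> Q \<and> s Q = fraction A I D Q a f)}"

definition frac_space ::
  "'a ring \<Rightarrow> 'a set \<Rightarrow> ('a \<times> 'a) set \<Rightarrow> 'a set set \<Rightarrow>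
    ('a set, 'a set \<Rightarrow> ('a \<times> 'a) set) rspace" where
  "frac_space A I D pts =
     \<lparr>utop = zariski A pts,
      sec = (\<lambda>U.
        \<lparr>carrier = frac_sections A I D pts U,
         monoid.mult = (\<lambda>s t. \<lambda>P\<in>U. \<Union>(a, f)\<in>s P. \<Union>(b, g)\<in>t P.
           fraction A I D P (a \<otimes>\<^bsub>A\<^esub> b) (f \<otimes>\<^bsub>A\<^esub> g)),
         one = (\<lambda>P\<in>U. fraction A I D P \<one>\<^bsub>A\<^esub> \<one>\<^bsub>A\<^esub>),
         ring.zero = (\<lambda>P\<in>U. fraction A I D P \<zero>\<^bsub>A\<^esub> \<one>\<^bsub>A\<^esub>),
         ring.add = (\<lambda>s t. \<lambda>P\<in>U. \<Union>(a, f)\<in>s P. \<Union>(b, g)\<in>t P.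
           fraction A I D P (a \<otimes>\<^bsub>A\<^esub> g \<oplus>\<^bsub>A\<^esub> b \<otimes>\<^bsub>A\<^esub> f) (f \<otimes>\<^bsub>A\<^esub> g))\<rparr>),
      res = (\<lambda>U V s. restrict s V)\<rparr>"

definition Spec :: "'a ring \<Rightarrow> ('a set, 'a set \<Rightarrow> ('a \<times> 'a) set) rspace" where
  "Spec A = frac_space A {\<zero>\<^bsub>A\<^esub>} (carrier A \<times> carrier A) {P. primeideal P A}"

text \<open>If an open subspace is isomorphic to Spec of some ring, then that ring is isomorphic to its
  ring of sections.\<close>

definition affine_open :: "('x, 'r, 'z) rspace_scheme \<Rightarrow> 'x set \<Rightarrow> bool" where
  "affine_open S U \<longleftrightarrow>
     openin (utop S) U \<and> rspace_isomorphic (open_subspace S U) (Spec (sec S U))"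

text \<open>Polynomials in the variables \<open>x\<^sub>0, \<dots>, x\<^sub>n\<close>.\<close>

type_synonym 'k mpoly = "(nat \<Rightarrow>\<^sub>0 nat) \<Rightarrow>\<^sub>0 'k"

definition poly_ring :: "nat \<Rightarrow> 'k::field mpoly ring" where
  "poly_ring n =
     ring_of_type_algebra\<lparr>carrier := {p. \<forall>m\<in>Poly_Mapping.keys p. Poly_Mapping.keys m \<subseteq> {..n}}\<rparr>"

definition pvar :: "nat \<Rightarrow> 'k::field mpoly" where
  "pvar i = Poly_Mapping.single (Poly_Mapping.single i 1) 1"

definition pconst :: "'k::field \<Rightarrow> 'k mpoly" where
  "pconst a = Poly_Mapping.single 0 a"

definition homogeneous :: "nat \<Rightarrow> 'k::field mpoly \<Rightarrow> bool" where
  "homogeneous d p \<longleftrightarrow>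
     (\<forall>m\<in>Poly_Mapping.keys p. (\<Sum>i\<in>Poly_Mapping.keys m. Poly_Mapping.lookup m i) = d)"

definition homogeneous_ideal :: "nat \<Rightarrow> 'k::field mpoly set \<Rightarrow> bool" where
  "homogeneous_ideal n I \<longleftrightarrow>
     ideal I (poly_ring n) \<and> I = Idl\<^bsub>poly_ring n\<^esub> {p \<in> I. \<exists>d. homogeneous d p}"

definition Proj_points :: "nat \<Rightarrow> 'k::field mpoly set \<Rightarrow> 'k mpoly set set" where
  "Proj_points n I =
     {P. primeideal P (poly_ring n) \<and> homogeneous_ideal n P \<and> I \<subseteq> P \<and> (\<exists>i\<le>n. pvar i \<notin> P)}"

definition Proj_fracs :: "nat \<Rightarrow> ('k::field mpoly \<times> 'k mpoly) set" where
  "Proj_fracs n =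
     {(a, f). a \<in> carrier (poly_ring n) \<and> f \<in> carrier (poly_ring n) \<and>
        (\<exists>d. homogeneous d a \<and> homogeneous d f)}"

text \<open>\<open>Proj n I\<close> is Proj of \<open>K[x\<^sub>0, \<dots>, x\<^sub>n] / I\<close>, i.e. the closed subscheme of projective space cut
  out by \<open>I\<close>.\<close>

definition Proj ::
  "nat \<Rightarrow> 'k::field mpoly set \<Rightarrow> ('k mpoly set, 'k mpoly set \<Rightarrow> ('k mpoly \<times> 'k mpoly) set, 'k) kspace"
  where
  "Proj n I =
     (let F = frac_space (poly_ring n) I (Proj_fracs n) (Proj_points n I)
      in \<lparr>utop = utop F, sec = sec F, res = res F,
          str = (\<lambda>a. \<lambda>P\<in>Proj_points n I. fraction (poly_ring n) I (Proj_fracs n) P (pconst a) 1)\<rparr>)"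

definition projective_scheme :: "('x, 'r, 'k::field) kspace \<Rightarrow> bool" where
  "projective_scheme S \<longleftrightarrow>
     ringed_kspace S \<and> (\<exists>n I. homogeneous_ideal n I \<and> kspace_isomorphic S (Proj n I))"

text \<open>The extension of an ideal to polynomials over the algebraic closure. The base change of
  \<open>Proj (K[x]/I)\<close> to the algebraic closure \<open>K'\<close> is \<open>Proj (K'[x]/I K'[x])\<close>. A scheme is
  geometrically integral if its base change to the algebraic closure is integral; equivalently, if
  its base change to every extension field is.\<close>

definition ideal_ac :: "nat \<Rightarrow> 'k::field mpoly set \<Rightarrow> 'k alg_closure mpoly set" where
  "ideal_ac n I = Idl\<^bsub>poly_ring n\<^esub> (Poly_Mapping.map to_ac ` I)"

definition geometrically_integral :: "('x, 'r, 'k::field) kspace \<Rightarrow> bool" where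
  "geometrically_integral S \<longleftrightarrow>
     (\<exists>n I. homogeneous_ideal n I \<and> kspace_isomorphic S (Proj n I) \<and>
        integral_rspace (Proj n (ideal_ac n I)))"

section \<open>Sections of powers of a line bundle\<close>

definition power_stalk ::
  "('x, 'r, 'z) rspace_scheme \<Rightarrow> ('x, 'r, 'm) modsheaf \<Rightarrow> nat \<Rightarrow> 'x \<Rightarrow>
    (('x set \<times> 'r) set, (('x set \<times> 'r) set, ('x set \<times> 'm) set) ftensor set) module" where
  "power_stalk S L k x = tensor_power (stalk S x) (mstalk S L x) k"

definition ftensor_germ ::
  "('x, 'r, 'z) rspace_scheme \<Rightarrow> ('x, 'r, 'm) modsheaf \<Rightarrow> nat \<Rightarrow> 'x \<Rightarrow> 'x set \<Rightarrow> ('r, 'm) ftensor \<Rightarrow>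
    (('x set \<times> 'r) set, ('x set \<times> 'm) set) ftensor set" where
  "ftensor_germ S L k x U w =
     tensor_class (stalk S x) (mstalk S L x) k
       (map (\<lambda>(a, ss). (rgerm S x U a, map (mgerm S L x U) ss)) w)"

type_synonym ('x, 'r, 'm) psection =
  "'x \<Rightarrow> (('x set \<times> 'r) set, ('x set \<times> 'm) set) ftensor set"

text \<open>The sheaf \<open>L\<^sup>\<otimes>\<^sup>k\<close> is the sheafification of \<open>U \<mapsto> L(U)\<^sup>\<otimes>\<^sup>k\<close>. The stalks of this presheaf are the
  \<open>(L\<^sub>x)\<^sup>\<otimes>\<^sup>k\<close>, so a section of the sheafification is a function \<open>x \<mapsto> s x \<in> (L\<^sub>x)\<^sup>\<otimes>\<^sup>k\<close> that is locally the
  family of germs of a tensor of sections of \<open>L\<close>.\<close>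

definition power_sections ::
  "('x, 'r, 'z) rspace_scheme \<Rightarrow> ('x, 'r, 'm) modsheaf \<Rightarrow> nat \<Rightarrow> 'x set \<Rightarrow>
    ('x, 'r, 'm) psection set" where
  "power_sections S L k U =
     {s \<in> extensional U. \<forall>x\<in>U. \<exists>V w. openin (utop S) V \<and> x \<in> V \<and> V \<subseteq> U \<and>
        w \<in> ftensors (sec S V) (msec L V) k \<and> (\<forall>y\<in>V. s y = ftensor_germ S L k y V w)}"

text \<open>\<open>H0 S L k\<close> is the vector space of global sections of \<open>L\<^sup>\<otimes>\<^sup>k\<close>.\<close>

definition H0 ::
  "('x, 'r, 'k::field) kspace \<Rightarrow> ('x, 'r, 'm) modsheaf \<Rightarrow> nat \<Rightarrow>
    ('k, ('x, 'r, 'm) psection) module" where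
  "H0 S L k =
     \<lparr>carrier = power_sections S L k (topspace (utop S)),
      monoid.mult = (\<lambda>_ _. undefined), one = undefined,
      ring.zero = (\<lambda>x\<in>topspace (utop S). \<zero>\<^bsub>power_stalk S L k x\<^esub>),
      ring.add = (\<lambda>s t. \<lambda>x\<in>topspace (utop S). s x \<oplus>\<^bsub>power_stalk S L k x\<^esub> t x),
      smult = (\<lambda>a s. \<lambda>x\<in>topspace (utop S).
        rgerm S x (topspace (utop S)) (str S a) \<odot>\<^bsub>power_stalk S L k x\<^esub> s x)\<rparr>"

definition sec_mult ::
  "('x, 'r, 'z) rspace_scheme \<Rightarrow> ('x, 'r, 'm) modsheaf \<Rightarrow> nat \<Rightarrow> nat \<Rightarrow>
    ('x, 'r, 'm) psection \<Rightarrow> ('x, 'r, 'm) psection \<Rightarrow> ('x, 'r, 'm) psection" where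
  "sec_mult S L k l s t =
     (\<lambda>x\<in>topspace (utop S). tensor_mult (stalk S x) (mstalk S L x) k l (s x) (t x))"

text \<open>The locus where a section of \<open>L\<^sup>\<otimes>\<^sup>k\<close> does not vanish, i.e. \<open>s x\<close> is not in \<open>\<mm>\<^sub>x (L\<^sub>x)\<^sup>\<otimes>\<^sup>k\<close>. As
  \<open>(L\<^sub>x)\<^sup>\<otimes>\<^sup>k\<close> is free of rank one over the local ring at \<open>x\<close>, every element of \<open>\<mm>\<^sub>x (L\<^sub>x)\<^sup>\<otimes>\<^sup>k\<close> is a
  single product of a nonunit and an element.\<close>

definition nonvanishing_locus ::
  "('x, 'r, 'z) rspace_scheme \<Rightarrow> ('x, 'r, 'm) modsheaf \<Rightarrow> nat \<Rightarrow> ('x, 'r, 'm) psection \<Rightarrow> 'x set" where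
  "nonvanishing_locus S L k s =
     {x \<in> topspace (utop S).
        \<not> (\<exists>a\<in>carrier (stalk S x) - Units (stalk S x). \<exists>v\<in>carrier (power_stalk S L k x).
             s x = a \<odot>\<^bsub>power_stalk S L k x\<^esub> v)}"

definition ample :: "('x, 'r, 'z) rspace_scheme \<Rightarrow> ('x, 'r, 'm) modsheaf \<Rightarrow> bool" where
  "ample S L \<longleftrightarrow>
     line_bundle S L \<and> compact_space (utop S) \<and>
     (\<forall>x\<in>topspace (utop S). \<exists>k\<ge>1. \<exists>s\<in>power_sections S L k (topspace (utop S)).
        x \<in> nonvanishing_locus S L k s \<and> affine_open S (nonvanishing_locus S L k s))"

section \<open>Bounded graded norms\<close>

text \<open>The product in \<open>H\<^sup>0(m r L)\<close> of a list of \<open>m\<close> sections in \<open>H\<^sup>0(r L)\<close>. The empty product is the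
  section 1 of \<open>0 L\<close>.\<close>

primrec sec_prod ::
  "('x, 'r, 'z) rspace_scheme \<Rightarrow> ('x, 'r, 'm) modsheaf \<Rightarrow> nat \<Rightarrow>
    ('x, 'r, 'm) psection list \<Rightarrow> ('x, 'r, 'm) psection" where
  "sec_prod S L r [] =
     (\<lambda>x\<in>topspace (utop S). tensor_class (stalk S x) (mstalk S L x) 0 [(\<one>\<^bsub>stalk S x\<^esub>, [])])"
| "sec_prod S L r (s # ss) = sec_mult S L r (length ss * r) s (sec_prod S L r ss)"

definition sym_carrier :: "('k::field, 'v) module \<Rightarrow> nat \<Rightarrow> ('k, 'v) ftensor set set" where
  "sym_carrier V m = sym_class ring_of_type_algebra V m ` ftensors ring_of_type_algebra V m"

text \<open>The multiplication map from the \<open>m\<close>-th symmetric power of \<open>H\<^sup>0(r L)\<close> to \<open>H\<^sup>0(r m L)\<close>;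
  its value does not depend on the representative of the class.\<close>

definition sym_mult_map ::
  "('x, 'r, 'k::field) kspace \<Rightarrow> ('x, 'r, 'm) modsheaf \<Rightarrow> nat \<Rightarrow> nat \<Rightarrow>
    ('k, ('x, 'r, 'm) psection) ftensor set \<Rightarrow> ('x, 'r, 'm) psection" where
  "sym_mult_map S L r m c =
     the_elem ((\<lambda>w. foldr (\<lambda>(a, ss) y. (a \<odot>\<^bsub>H0 S L (r * m)\<^esub> sec_prod S L r ss) \<oplus>\<^bsub>H0 S L (r * m)\<^esub> y)
       w \<zero>\<^bsub>H0 S L (r * m)\<^esub>) ` c)"

text \<open>The quotient norm along a surjection \<open>\<pi>\<close> from \<open>S\<close>; the fibres of \<open>\<pi>\<close> are the cosets of its
  kernel.\<close>

definition quotient_norm :: "'v set \<Rightarrow> ('v \<Rightarrow> 'w) \<Rightarrow> ('v \<Rightarrow> real) \<Rightarrow> 'w \<Rightarrow> real" where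
  "quotient_norm S \<pi> \<zeta> w = Inf (\<zeta> ` {v \<in> S. \<pi> v = w})"

definition tensor_norm ::
  "('k::field, 'v) module \<Rightarrow> ('v \<Rightarrow> real) \<Rightarrow> nat \<Rightarrow> ('k, 'v) ftensor set \<Rightarrow> real" where
  "tensor_norm V \<zeta> m c =
     Inf {Max (insert 0 (set (map (\<lambda>vs. prod_list (map \<zeta> vs)) ws))) | ws.
       ws \<in> lists {vs. length vs = m \<and> set vs \<subseteq> carrier V} \<and>
       c = tensor_class ring_of_type_algebra V m (map (\<lambda>vs. (1, vs)) ws)}"

definition sym_norm ::
  "('k::field, 'v) module \<Rightarrow> ('v \<Rightarrow> real) \<Rightarrow> nat \<Rightarrow> ('k, 'v) ftensor set \<Rightarrow> real" where
  "sym_norm V \<zeta> m =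
     quotient_norm (carrier (tensor_power ring_of_type_algebra V m))
       (\<lambda>c. \<Union>u\<in>c. sym_class ring_of_type_algebra V m u) (tensor_norm V \<zeta> m)"

definition induced_norm ::
  "('x, 'r, 'k::field) kspace \<Rightarrow> ('x, 'r, 'm) modsheaf \<Rightarrow> nat \<Rightarrow>
    (('x, 'r, 'm) psection \<Rightarrow> real) \<Rightarrow> nat \<Rightarrow> ('x, 'r, 'm) psection \<Rightarrow> real" where
  "induced_norm S L r \<zeta> m =
     quotient_norm (sym_carrier (H0 S L r) m) (sym_mult_map S L r m) (sym_norm (H0 S L r) \<zeta> m)"

definition graded_norm ::
  "('k::field \<Rightarrow> real) \<Rightarrow> ('x, 'r, 'k) kspace \<Rightarrow> ('x, 'r, 'm) modsheaf \<Rightarrow>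
    (nat \<Rightarrow> ('x, 'r, 'm) psection \<Rightarrow> real) \<Rightarrow> bool" where
  "graded_norm av S L \<zeta> \<longleftrightarrow>
     (\<forall>k. norm_on av (H0 S L k) (\<zeta> k)) \<and>
     (\<forall>k l. \<forall>s\<in>carrier (H0 S L k). \<forall>s'\<in>carrier (H0 S L l).
        \<zeta> (k + l) (sec_mult S L k l s s') \<le> \<zeta> k s * \<zeta> l s')"

definition bounded_graded_norm ::
  "('k::field \<Rightarrow> real) \<Rightarrow> ('x, 'r, 'k) kspace \<Rightarrow> ('x, 'r, 'm) modsheaf \<Rightarrow>
    (nat \<Rightarrow> ('x, 'r, 'm) psection \<Rightarrow> real) \<Rightarrow> bool" where
  "bounded_graded_norm av S L \<zeta> \<longleftrightarrow>
     graded_norm av S L \<zeta> \<and>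
     (\<exists>r \<zeta>' C. r \<ge> 1 \<and> C > 0 \<and>
        (\<forall>m\<ge>1. sym_mult_map S L r m ` sym_carrier (H0 S L r) m = carrier (H0 S L (r * m))) \<and>
        norm_on av (H0 S L r) \<zeta>' \<and>
        (\<forall>m\<ge>1. \<forall>s\<in>carrier (H0 S L (r * m)).
           exp (- (real r * real m * C)) * induced_norm S L r \<zeta>' m s \<le> \<zeta> (r * m) s \<and>
           \<zeta> (r * m) s \<le> exp (real r * real m * C) * induced_norm S L r \<zeta>' m s))"

end

theory Submission
  imports Defs
begin

text \<open>At the level of diagonalizable norms submultiplicativity is an inequality for each matrix
  coefficient of the product in diagonalizing bases, and such inequalities are stable under weighted
  geometric means; the ultrametric inequality extends the result from basis vectors to all vectors.
  General norms agree with diagonalizable ones up to a factor \<open>exp e\<close>, so the product has norm at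
  most \<open>exp (3 * e)\<close> along the approximating geodesics, and \<open>e\<close> tends to 0.\<close>

text \<open>The diagonalizing bases of the three spaces are unrelated to each other and to the
  product. What ties the two ends of a geodesic together is that one basis diagonalizes both
  endpoint norms: the coefficients c of a product of basis vectors are then the same at all times,
  and |c| is its own weighted geometric mean. As a diagonalized norm is exactly a maximum over
  coefficients, a bound on it is the same as one inequality per coefficient. The approximating norms
  need not be submultiplicative, only up to a constant. The diagonal case is therefore proved with
  an arbitrary constant C > 0, which interpolates to itself. The bases change along the
  approximation, so the error must be uniform over all vectors. All this concerns an arbitrary
  bilinear map. The longer part of the proof shows that the product of sections is one. Sections are
  families of classes of formal tensors over stalks, and operations on classes are unions over
  representatives, so each algebraic law has to be checked against the choice of representatives and
  of neighbourhoods.\<close>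

lemma ring_of_type_algebra_simps [simp]:
  "carrier ring_of_type_algebra = UNIV"
  "x \<otimes>\<^bsub>ring_of_type_algebra\<^esub> y = x * y"
  "x \<oplus>\<^bsub>ring_of_type_algebra\<^esub> y = x + y"
  "\<one>\<^bsub>ring_of_type_algebra\<^esub> = 1"
  "\<zero>\<^bsub>ring_of_type_algebra\<^esub> = 0"
  by (simp_all add: ring_of_type_algebra_def)

section \<open>Diagonalized norms\<close>

text \<open>A vector space is a module over the field viewed as a HOL-Algebra ring. Finite dimension
  enters through the diagonalizing bases, which are indexed by \<open>{..<n}\<close>.\<close>

locale vector_module = module ring_of_type_algebra V for V :: "('k::field, 'v) module"
begin

lemma lincomb_add:
  assumes "s \<in> {..<n} \<rightarrow> carrier V"
  shows "lincomb V n s a \<oplus>\<^bsub>V\<^esub> lincomb V n s b = lincomb V n s (\<lambda>i. a i + b i)"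
proof -
  have "(\<Oplus>\<^bsub>V\<^esub>i\<in>{..<n}. (a i + b i) \<odot>\<^bsub>V\<^esub> s i) =
        (\<Oplus>\<^bsub>V\<^esub>i\<in>{..<n}. a i \<odot>\<^bsub>V\<^esub> s i \<oplus>\<^bsub>V\<^esub> b i \<odot>\<^bsub>V\<^esub> s i)"
    using assms smult_l_distr by (intro finsum_cong') (auto simp: Pi_iff)
  also have "\<dots> = (\<Oplus>\<^bsub>V\<^esub>i\<in>{..<n}. a i \<odot>\<^bsub>V\<^esub> s i) \<oplus>\<^bsub>V\<^esub> (\<Oplus>\<^bsub>V\<^esub>i\<in>{..<n}. b i \<odot>\<^bsub>V\<^esub> s i)"
    using assms by (intro finsum_addf) auto
  finally show ?thesis
    by (simp add: lincomb_def)
qed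

lemma smult_lincomb:
  assumes "s \<in> {..<n} \<rightarrow> carrier V"
  shows "c \<odot>\<^bsub>V\<^esub> lincomb V n s a = lincomb V n s (\<lambda>i. c * a i)"
proof -
  have "c \<odot>\<^bsub>V\<^esub> (\<Oplus>\<^bsub>V\<^esub>i\<in>{..<n}. a i \<odot>\<^bsub>V\<^esub> s i) = (\<Oplus>\<^bsub>V\<^esub>i\<in>{..<n}. c \<odot>\<^bsub>V\<^esub> (a i \<odot>\<^bsub>V\<^esub> s i))"
    using assms by (intro finsum_smult_ldistr) auto
  also have "\<dots> = (\<Oplus>\<^bsub>V\<^esub>i\<in>{..<n}. (c * a i) \<odot>\<^bsub>V\<^esub> s i)"
    using assms smult_assoc1 by (intro finsum_cong') (auto simp: Pi_iff)
  finally show ?thesis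
    by (simp add: lincomb_def)
qed

lemma lincomb_zero:
  assumes "s \<in> {..<n} \<rightarrow> carrier V"
  shows "lincomb V n s (\<lambda>i. 0) = \<zero>\<^bsub>V\<^esub>"
proof -
  have "(\<Oplus>\<^bsub>V\<^esub>i\<in>{..<n}. 0 \<odot>\<^bsub>V\<^esub> s i) = (\<Oplus>\<^bsub>V\<^esub>i\<in>{..<n}. \<zero>\<^bsub>V\<^esub>)"
    using assms smult_l_null by (intro finsum_cong') (auto simp: Pi_iff)
  then show ?thesis
    by (simp add: lincomb_def)
qed

end

lemma nonarch_absD:
  assumes "nonarch_abs av"
  shows "0 \<le> av a" "av 0 = 0" "av (a * b) = av a * av b" "av (a + b) \<le> max (av a) (av b)"
  using assms by (auto simp: nonarch_abs_def)

text \<open>A maximum is bounded by \<open>M\<close> iff each entry is; the inserted 0 contributes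
  \<open>0 \<le> M\<close>. Since \<open>a\<close> is arbitrary, coefficient functions need not be
  extensional here.\<close>

lemma diagonalized_by_le_iff:
  assumes "diagonalized_by av V \<zeta> n s"
  shows "\<zeta> (lincomb V n s a) \<le> M \<longleftrightarrow> 0 \<le> M \<and> (\<forall>i<n. av (a i) * \<zeta> (s i) \<le> M)"
  using assms by (auto simp: diagonalized_by_def)

lemma diagonalized_by_vec: "diagonalized_by av V \<zeta> n s \<Longrightarrow> s \<in> {..<n} \<rightarrow> carrier V"
  by (auto simp: diagonalized_by_def is_basis_def)

lemma diagonalized_by_coeffs:
  assumes "diagonalized_by av V \<zeta> n s" and "v \<in> carrier V"
  obtains a where "v = lincomb V n s a"
  using assms by (auto simp: diagonalized_by_def is_basis_def dest!: bspec)

text \<open>\<open>diag_geodesic_at\<close> says of the interpolated function only that it is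
  diagonalized, so the norm properties used below are derived from the diagonal formula alone.
  Nonnegativity is the 0 in the maximum, read off with \<open>M = \<zeta> v\<close>.\<close>

lemma diagonalized_by_nonneg:
  assumes "diagonalized_by av V \<zeta> n s" and "v \<in> carrier V"
  shows "0 \<le> \<zeta> v"
  using diagonalized_by_coeffs[OF assms] diagonalized_by_le_iff[OF assms(1)] by (metis order.refl)

context vector_module
begin

lemma diagonalized_by_zero:
  assumes "nonarch_abs av" and "diagonalized_by av V \<zeta> n s"
  shows "\<zeta> \<zero>\<^bsub>V\<^esub> = 0"
proof (rule antisym)
  have "\<zeta> (lincomb V n s (\<lambda>i. 0)) \<le> 0"
    by (simp add: diagonalized_by_le_iff[OF assms(2)] nonarch_absD(2)[OF assms(1)])
  then show "\<zeta> \<zero>\<^bsub>V\<^esub> \<le> 0"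
    by (simp add: lincomb_zero[OF diagonalized_by_vec[OF assms(2)]])
qed (rule diagonalized_by_nonneg[OF assms(2) zero_closed])

lemma diagonalized_by_smult:
  assumes av: "nonarch_abs av" and D: "diagonalized_by av V \<zeta> n s" and "v \<in> carrier V"
  shows "\<zeta> (c \<odot>\<^bsub>V\<^esub> v) \<le> av c * \<zeta> v"
proof -
  obtain a where v: "v = lincomb V n s a"
    using diagonalized_by_coeffs[OF D \<open>v \<in> carrier V\<close>] .
  have "av (a i) * \<zeta> (s i) \<le> \<zeta> v" if "i < n" for i
    using that diagonalized_by_le_iff[OF D, of a "\<zeta> v"] v by simp
  then show ?thesis
    using diagonalized_by_nonneg[OF D \<open>v \<in> carrier V\<close>] nonarch_absD[OF av]
    by (simp add: v smult_lincomb[OF diagonalized_by_vec[OF D]] diagonalized_by_le_iff[OF D]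
        mult.assoc mult_left_mono)
qed

text \<open>The ultrametric inequality of \<open>av\<close>, applied to each coefficient, passes to
  the maximum.\<close>

lemma diagonalized_by_add:
  assumes av: "nonarch_abs av" and D: "diagonalized_by av V \<zeta> n s"
    and "v \<in> carrier V" and "w \<in> carrier V"
  shows "\<zeta> (v \<oplus>\<^bsub>V\<^esub> w) \<le> max (\<zeta> v) (\<zeta> w)"
proof -
  obtain a where v: "v = lincomb V n s a"
    using diagonalized_by_coeffs[OF D \<open>v \<in> carrier V\<close>] .
  obtain b where w: "w = lincomb V n s b"
    using diagonalized_by_coeffs[OF D \<open>w \<in> carrier V\<close>] .
  have "av (a i + b i) * \<zeta> (s i) \<le> max (\<zeta> v) (\<zeta> w)" if "i < n" for i
  proof -
    have 1: "av (a i) * \<zeta> (s i) \<le> \<zeta> v" "av (b i) * \<zeta> (s i) \<le> \<zeta> w"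
      using that diagonalized_by_le_iff[OF D, of a "\<zeta> v"] diagonalized_by_le_iff[OF D, of b "\<zeta> w"] v w
      by simp_all
    have "s i \<in> carrier V"
      using that diagonalized_by_vec[OF D] by auto
    then have "av (a i + b i) * \<zeta> (s i) \<le> max (av (a i)) (av (b i)) * \<zeta> (s i)"
      by (intro mult_right_mono nonarch_absD(4)[OF av] diagonalized_by_nonneg[OF D])
    also have "\<dots> \<le> max (\<zeta> v) (\<zeta> w)"
      using 1 by (auto simp: max_def)
    finally show ?thesis .
  qed
  then show ?thesis
    unfolding v w lincomb_add[OF diagonalized_by_vec[OF D]] diagonalized_by_le_iff[OF D]
    using diagonalized_by_nonneg[OF D \<open>v \<in> carrier V\<close>] by (simp add: v w max.coboundedI1)
qed

text \<open>The operator norm of a linear map can be tested on a diagonalizing basis of the source: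
  \<open>\<eta> (f v)\<close> is at most the maximum of the
  \<open>av (a i) * \<eta> (f (s i))\<close>, hence at most \<open>M\<close> times the maximum of
  the \<open>av (a i) * \<zeta> (s i)\<close>, which equals \<open>\<zeta> v\<close>. The target
  contributes only homogeneity and the ultrametric inequality.\<close>

lemma diagonalized_by_linear_le:
  assumes av: "nonarch_abs av" and D: "diagonalized_by av V \<zeta> n s"
    and "vector_module W" and D': "diagonalized_by av W \<eta> m w"
    and f: "f \<in> carrier V \<rightarrow> carrier W" "f \<zero>\<^bsub>V\<^esub> = \<zero>\<^bsub>W\<^esub>"
      "\<And>x y. x \<in> carrier V \<Longrightarrow> y \<in> carrier V \<Longrightarrow> f (x \<oplus>\<^bsub>V\<^esub> y) = f x \<oplus>\<^bsub>W\<^esub> f y"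
      "\<And>a x. x \<in> carrier V \<Longrightarrow> f (a \<odot>\<^bsub>V\<^esub> x) = a \<odot>\<^bsub>W\<^esub> f x"
    and "0 \<le> M" and le: "\<And>i. i < n \<Longrightarrow> \<eta> (f (s i)) \<le> M * \<zeta> (s i)"
    and "v \<in> carrier V"
  shows "\<eta> (f v) \<le> M * \<zeta> v"
proof -
  interpret W: vector_module W by fact
  obtain a where v: "v = lincomb V n s a"
    using diagonalized_by_coeffs[OF D \<open>v \<in> carrier V\<close>] .
  have s: "s i \<in> carrier V" if "i < n" for i
    using that diagonalized_by_vec[OF D] by auto
  have term_le: "\<eta> (f (a i \<odot>\<^bsub>V\<^esub> s i)) \<le> M * \<zeta> v" if "i < n" for i
  proof -
    have "\<eta> (f (a i \<odot>\<^bsub>V\<^esub> s i)) \<le> av (a i) * \<eta> (f (s i))"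
      using f s[OF that] W.diagonalized_by_smult[OF av D'] by (auto simp: Pi_iff)
    also have "\<dots> \<le> av (a i) * (M * \<zeta> (s i))"
      by (intro mult_left_mono le that nonarch_absD(1)[OF av])
    also have "\<dots> = M * (av (a i) * \<zeta> (s i))"
      by simp
    also have "\<dots> \<le> M * \<zeta> v"
      using that diagonalized_by_le_iff[OF D, of a "\<zeta> v"] v \<open>0 \<le> M\<close> by (intro mult_left_mono) auto
    finally show ?thesis .
  qed
  \<comment> \<open>Partial sums are compared with the norm of the whole vector \<open>v\<close>.
    The ultrametric inequality costs no constant, so the same bound survives each further
    summand.\<close>
  have "\<eta> (f (\<Oplus>\<^bsub>V\<^esub>i\<in>A. a i \<odot>\<^bsub>V\<^esub> s i)) \<le> M * \<zeta> v" if "finite A" "A \<subseteq> {..<n}" for A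
    using that
  proof (induction A)
    case empty
    then show ?case
      using f(2) W.diagonalized_by_zero[OF av D'] diagonalized_by_nonneg[OF D \<open>v \<in> carrier V\<close>] \<open>0 \<le> M\<close>
      by simp
  next
    case (insert i A)
    let ?y = "\<Oplus>\<^bsub>V\<^esub>i\<in>A. a i \<odot>\<^bsub>V\<^esub> s i"
    have 1: "?y \<in> carrier V" "a i \<odot>\<^bsub>V\<^esub> s i \<in> carrier V"
      using insert.prems s by (auto intro!: finsum_closed)
    have "(\<Oplus>\<^bsub>V\<^esub>i\<in>insert i A. a i \<odot>\<^bsub>V\<^esub> s i) = a i \<odot>\<^bsub>V\<^esub> s i \<oplus>\<^bsub>V\<^esub> ?y"
      using insert s by (intro finsum_insert) auto
    then have "f (\<Oplus>\<^bsub>V\<^esub>i\<in>insert i A. a i \<odot>\<^bsub>V\<^esub> s i) = f (a i \<odot>\<^bsub>V\<^esub> s i) \<oplus>\<^bsub>W\<^esub> f ?y"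
      using f(3) 1 by simp
    then have "\<eta> (f (\<Oplus>\<^bsub>V\<^esub>i\<in>insert i A. a i \<odot>\<^bsub>V\<^esub> s i)) \<le> max (\<eta> (f (a i \<odot>\<^bsub>V\<^esub> s i))) (\<eta> (f ?y))"
      using f(1) 1 W.diagonalized_by_add[OF av D'] by auto
    also have "\<dots> \<le> M * \<zeta> v"
      using insert term_le[of i] by simp
    finally show ?case .
  qed
  from this[of "{..<n}"] show ?thesis
    by (simp add: v lincomb_def)
qed

end

section \<open>Interpolation of bilinear maps\<close>

text \<open>Both \<open>c\<close> and \<open>C\<close> are the same in the two hypotheses, so each
  is the product of its powers with exponents \<open>1 - t\<close> and \<open>t\<close>; what
  remains is monotonicity of powers. In the application \<open>c\<close> is the absolute value of a
  matrix coefficient.\<close>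

lemma geometric_mean_mono:
  fixes t :: real
  assumes "t \<in> {0..1}" "0 < C"
    and "0 \<le> c" "0 \<le> a0" "0 \<le> a1" "0 \<le> b0" "0 \<le> b1" "0 \<le> d0" "0 \<le> d1"
    and 0: "c * a0 \<le> C * b0 * d0" and 1: "c * a1 \<le> C * b1 * d1"
  shows "c * (a0 powr (1 - t) * a1 powr t) \<le>
         C * (b0 powr (1 - t) * b1 powr t) * (d0 powr (1 - t) * d1 powr t)"
proof -
  \<comment> \<open>Also true for \<open>x = 0\<close>, including the endpoints \<open>t = 0\<close>
    and \<open>t = 1\<close>, because \<open>0 powr 0 = 0\<close>.\<close>
  have split: "x = x powr (1 - t) * x powr t" if "0 \<le> x" for x :: real
    using that by (simp flip: powr_add)
  have "c * (a0 powr (1 - t) * a1 powr t) = (c * a0) powr (1 - t) * (c * a1) powr t"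
    using assms by (subst (1) split[of c]) (simp_all add: powr_mult)
  also have "\<dots> \<le> (C * b0 * d0) powr (1 - t) * (C * b1 * d1) powr t"
    using assms by (intro mult_mono[of "_ powr _"] powr_mono2) auto
  also have "\<dots> = C * (b0 powr (1 - t) * b1 powr t) * (d0 powr (1 - t) * d1 powr t)"
    using assms split[of C] by (simp add: powr_mult mult_ac)
  finally show ?thesis .
qed

text \<open>The interface between metric and geometry: \<open>B\<close> stands for the product of
  sections, and \<open>V\<close>, \<open>W\<close>, \<open>U\<close> for the sections of degree k, l
  and k + l.\<close>

locale bilinear_pairing =
  V: vector_module V + W: vector_module W + U: vector_module U
  for V :: "('k::field, 'v) module" and W :: "('k, 'w) module" and U :: "('k, 'u) module" +
  fixes B :: "'v \<Rightarrow> 'w \<Rightarrow> 'u"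
  assumes closed: "v \<in> carrier V \<Longrightarrow> w \<in> carrier W \<Longrightarrow> B v w \<in> carrier U"
    and zero_left: "w \<in> carrier W \<Longrightarrow> B \<zero>\<^bsub>V\<^esub> w = \<zero>\<^bsub>U\<^esub>"
    and zero_right: "v \<in> carrier V \<Longrightarrow> B v \<zero>\<^bsub>W\<^esub> = \<zero>\<^bsub>U\<^esub>"
    and add_left: "v \<in> carrier V \<Longrightarrow> v' \<in> carrier V \<Longrightarrow> w \<in> carrier W \<Longrightarrow>
      B (v \<oplus>\<^bsub>V\<^esub> v') w = B v w \<oplus>\<^bsub>U\<^esub> B v' w"
    and add_right: "v \<in> carrier V \<Longrightarrow> w \<in> carrier W \<Longrightarrow> w' \<in> carrier W \<Longrightarrow>
      B v (w \<oplus>\<^bsub>W\<^esub> w') = B v w \<oplus>\<^bsub>U\<^esub> B v w'"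
    and smult_left: "v \<in> carrier V \<Longrightarrow> w \<in> carrier W \<Longrightarrow> B (a \<odot>\<^bsub>V\<^esub> v) w = a \<odot>\<^bsub>U\<^esub> B v w"
    and smult_right: "v \<in> carrier V \<Longrightarrow> w \<in> carrier W \<Longrightarrow> B v (a \<odot>\<^bsub>W\<^esub> w) = a \<odot>\<^bsub>U\<^esub> B v w"
begin

text \<open>A matrix coefficient of \<open>B\<close> in the diagonalizing bases satisfies \<open>|c| \<alpha> \<le> C \<beta> \<gamma>\<close> at both
  ends of the geodesics, hence at time \<open>t\<close> by taking a weighted geometric mean.\<close>

lemma diag_geodesic_at_bound:
  assumes av: "nonarch_abs av" and t: "t \<in> {0..1}" and "0 < C"
    and V: "diag_geodesic_at av V \<beta>0 \<beta>1 t \<beta>"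
    and W: "diag_geodesic_at av W \<gamma>0 \<gamma>1 t \<gamma>"
    and U: "diag_geodesic_at av U \<alpha>0 \<alpha>1 t \<alpha>"
    and 0: "\<And>v w. v \<in> carrier V \<Longrightarrow> w \<in> carrier W \<Longrightarrow> \<alpha>0 (B v w) \<le> C * \<beta>0 v * \<gamma>0 w"
    and 1: "\<And>v w. v \<in> carrier V \<Longrightarrow> w \<in> carrier W \<Longrightarrow> \<alpha>1 (B v w) \<le> C * \<beta>1 v * \<gamma>1 w"
    and v: "v \<in> carrier V" and w: "w \<in> carrier W"
  shows "\<alpha> (B v w) \<le> C * \<beta> v * \<gamma> w"
proof -
  obtain p x where V0: "diagonalized_by av V \<beta>0 p x" and V1: "diagonalized_by av V \<beta>1 p x"
    and Vt: "diagonalized_by av V \<beta> p x"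
    and \<beta>: "\<And>i. i < p \<Longrightarrow> \<beta> (x i) = \<beta>0 (x i) powr (1 - t) * \<beta>1 (x i) powr t"
    using V by (auto simp: diag_geodesic_at_def)
  obtain q y where W0: "diagonalized_by av W \<gamma>0 q y" and W1: "diagonalized_by av W \<gamma>1 q y"
    and Wt: "diagonalized_by av W \<gamma> q y"
    and \<gamma>: "\<And>i. i < q \<Longrightarrow> \<gamma> (y i) = \<gamma>0 (y i) powr (1 - t) * \<gamma>1 (y i) powr t"
    using W by (auto simp: diag_geodesic_at_def)
  obtain r z where U0: "diagonalized_by av U \<alpha>0 r z" and U1: "diagonalized_by av U \<alpha>1 r z"
    and Ut: "diagonalized_by av U \<alpha> r z"
    and \<alpha>: "\<And>i. i < r \<Longrightarrow> \<alpha> (z i) = \<alpha>0 (z i) powr (1 - t) * \<alpha>1 (z i) powr t"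
    using U by (auto simp: diag_geodesic_at_def)
  have x: "x i \<in> carrier V" if "i < p" for i
    using that diagonalized_by_vec[OF V0] by auto
  have y: "y j \<in> carrier W" if "j < q" for j
    using that diagonalized_by_vec[OF W0] by auto
  have z: "z k \<in> carrier U" if "k < r" for k
    using that diagonalized_by_vec[OF U0] by auto
  note nonneg = diagonalized_by_nonneg[OF V0] diagonalized_by_nonneg[OF V1]
    diagonalized_by_nonneg[OF Vt] diagonalized_by_nonneg[OF W0] diagonalized_by_nonneg[OF W1]
    diagonalized_by_nonneg[OF Wt] diagonalized_by_nonneg[OF U0] diagonalized_by_nonneg[OF U1]
  have basis: "\<alpha> (B (x i) (y j)) \<le> C * \<beta> (x i) * \<gamma> (y j)" if ij: "i < p" "j < q" for i j
  proof -
    have "B (x i) (y j) \<in> carrier U"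
      using ij x y closed by blast
    \<comment> \<open>The coefficients \<open>c\<close> belong to the basis \<open>z\<close> and not
      to a norm, so the same \<open>c\<close> is tested against \<open>\<alpha>0\<close>,
      \<open>\<alpha>1\<close> and \<open>\<alpha>\<close>.\<close>
    then obtain c where c: "B (x i) (y j) = lincomb U r z c"
      using diagonalized_by_coeffs[OF U0] by blast
    have "av (c k) * \<alpha> (z k) \<le> C * \<beta> (x i) * \<gamma> (y j)" if k: "k < r" for k
    proof -
      have "av (c k) * \<alpha>0 (z k) \<le> C * \<beta>0 (x i) * \<gamma>0 (y j)"
        using 0[OF x y, OF ij] k by (simp add: c diagonalized_by_le_iff[OF U0])
      moreover have "av (c k) * \<alpha>1 (z k) \<le> C * \<beta>1 (x i) * \<gamma>1 (y j)"
        using 1[OF x y, OF ij] k by (simp add: c diagonalized_by_le_iff[OF U1])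
      ultimately show ?thesis
        unfolding \<alpha>[OF k] \<beta>[OF ij(1)] \<gamma>[OF ij(2)]
        using t \<open>0 < C\<close> nonarch_absD(1)[OF av] nonneg x[OF ij(1)] y[OF ij(2)] z[OF k]
        by (intro geometric_mean_mono) auto
    qed
    \<comment> \<open>This is the condition coming from the extra 0 in the maximum.\<close>
    moreover have "0 \<le> C * \<beta> (x i) * \<gamma> (y j)"
      using \<open>0 < C\<close> nonneg x[OF ij(1)] y[OF ij(2)] by simp
    ultimately show ?thesis
      by (simp add: c diagonalized_by_le_iff[OF Ut])
  qed
  \<comment> \<open>The extension to all vectors goes one variable at a time. With
    \<open>y j\<close> fixed, \<open>B\<close> is linear in the first variable and is bounded on the
    basis \<open>x\<close> with constant \<open>C * \<gamma> (y j)\<close>.\<close>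
  have left: "\<alpha> (B v (y j)) \<le> (C * \<gamma> (y j)) * \<beta> v" if j: "j < q" for j
  proof (rule V.diagonalized_by_linear_le[OF av Vt U.vector_module_axioms Ut _ _ _ _ _ _ v])
    show "\<alpha> (B (x i) (y j)) \<le> (C * \<gamma> (y j)) * \<beta> (x i)" if "i < p" for i
      using basis[OF that j] by (simp add: mult_ac)
    show "0 \<le> C * \<gamma> (y j)"
      using \<open>0 < C\<close> nonneg y[OF j] by simp
  qed (use closed zero_left add_left smult_left y[OF j] in auto)
  \<comment> \<open>Now \<open>v\<close> is fixed and arbitrary; the previous bound is the basis
    estimate for the second variable, with constant \<open>C * \<beta> v\<close>.\<close>
  have "\<alpha> (B v w) \<le> (C * \<beta> v) * \<gamma> w"
  proof (rule W.diagonalized_by_linear_le[OF av Wt U.vector_module_axioms Ut _ _ _ _ _ _ w])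
    show "\<alpha> (B v (y j)) \<le> (C * \<beta> v) * \<gamma> (y j)" if "j < q" for j
      using left[OF that] by (simp add: mult_ac)
    show "0 \<le> C * \<beta> v"
      using \<open>0 < C\<close> nonneg v by simp
  qed (use closed zero_right add_right smult_right v in auto)
  then show ?thesis .
qed

end

section \<open>Passage from diagonalizable norms to arbitrary norms\<close>

text \<open>Away from the origin this is the exponential of the logarithmic estimate; at the zero
  vector, where the supremum is not taken, both norms vanish. The index from which the bound holds
  is the same for all \<open>v\<close>.\<close>

lemma norm_approx_bound:
  assumes Z: "norm_approx av V Z \<zeta>" and \<zeta>: "norm_on av V \<zeta>" and "0 < e"
  shows "\<forall>\<^sub>F n in sequentially. \<forall>v\<in>carrier V. Z n v \<le> exp e * \<zeta> v \<and> \<zeta> v \<le> exp e * Z n v"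
proof -
  have "\<forall>\<^sub>F n in sequentially. \<forall>v\<in>carrier V - {\<zero>\<^bsub>V\<^esub>}. dist (ln (Z n v / \<zeta> v)) 0 < e"
    using Z \<open>0 < e\<close> by (auto simp: norm_approx_def dest: uniform_limitD)
  then show ?thesis
  proof eventually_elim
    case (elim n)
    have N: "norm_on av V (Z n)"
      using Z by (simp add: norm_approx_def diagonalizable_def)
    show ?case
    proof
      fix v assume v: "v \<in> carrier V"
      show "Z n v \<le> exp e * \<zeta> v \<and> \<zeta> v \<le> exp e * Z n v"
      proof (cases "v = \<zero>\<^bsub>V\<^esub>")
        case True
        then show ?thesis
          using N \<zeta> v by (auto simp: norm_on_def)
      next
        case False
        then have pos: "0 < Z n v" "0 < \<zeta> v"
          using N \<zeta> v by (auto simp: norm_on_def less_le)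
        have "\<bar>ln (Z n v) - ln (\<zeta> v)\<bar> < e"
          using elim[rule_format, of v] v False pos by (auto simp: ln_div)
        then have "ln (Z n v) \<le> ln (exp e * \<zeta> v)" "ln (\<zeta> v) \<le> ln (exp e * Z n v)"
          using pos by (auto simp: ln_mult)
        then show ?thesis
          using pos by simp
      qed
    qed
  qed
qed

text \<open>The 3 counts the comparisons: \<open>Zu n\<close> with \<open>\<alpha>\<close>, then
  \<open>\<beta>\<close> with \<open>Zv n\<close> and \<open>\<gamma>\<close> with
  \<open>Zw n\<close>. The vectors are quantified inside the eventuality because the estimate is
  used on bases that depend on \<open>n\<close>.\<close>

lemma (in bilinear_pairing) norm_approx_submult:
  assumes U: "norm_approx av U Zu \<alpha>" "norm_on av U \<alpha>"
    and V: "norm_approx av V Zv \<beta>" "norm_on av V \<beta>"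
    and W: "norm_approx av W Zw \<gamma>" "norm_on av W \<gamma>"
    and le: "\<And>v w. v \<in> carrier V \<Longrightarrow> w \<in> carrier W \<Longrightarrow> \<alpha> (B v w) \<le> \<beta> v * \<gamma> w"
    and "0 < e"
  shows "\<forall>\<^sub>F n in sequentially. \<forall>v\<in>carrier V. \<forall>w\<in>carrier W.
    Zu n (B v w) \<le> exp (3 * e) * Zv n v * Zw n w"
  using norm_approx_bound[OF U \<open>0 < e\<close>] norm_approx_bound[OF V \<open>0 < e\<close>]
    norm_approx_bound[OF W \<open>0 < e\<close>]
proof eventually_elim
  case (elim n)
  have "norm_on av V (Zv n)"
    using V(1) by (simp add: norm_approx_def diagonalizable_def)
  then have nonneg: "0 \<le> Zv n v" if "v \<in> carrier V" for v
    using that by (simp add: norm_on_def)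
  show ?case
  proof (intro ballI)
    fix v w assume v: "v \<in> carrier V" and w: "w \<in> carrier W"
    have "Zu n (B v w) \<le> exp e * \<alpha> (B v w)"
      using elim closed[OF v w] by blast
    also have "\<dots> \<le> exp e * (\<beta> v * \<gamma> w)"
      using le[OF v w] by simp
    also have "\<dots> \<le> exp e * ((exp e * Zv n v) * (exp e * Zw n w))"
      using elim v w W(2) nonneg[OF v] by (intro mult_left_mono mult_mono) (auto simp: norm_on_def)
    also have "\<dots> = exp (3 * e) * Zv n v * Zw n w"
      by (simp add: mult_ac flip: exp_add)
    finally show "Zu n (B v w) \<le> exp (3 * e) * Zv n v * Zw n w" .
  qed
qed

text \<open>Two limits, in this order: for fixed \<open>e\<close> the index \<open>n\<close> tends
  to infinity, and then \<open>e\<close> decreases to 0, as the index from which the estimate holds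
  depends on \<open>e\<close>. The approximating sequences of the three spaces are chosen
  independently and compared at the same \<open>n\<close>.\<close>

theorem (in bilinear_pairing) norm_geodesic_at_submult:
  assumes av: "nonarch_abs av" and t: "t \<in> {0..1}"
    and norms: "norm_on av U \<alpha>0" "norm_on av U \<alpha>1" "norm_on av V \<beta>0" "norm_on av V \<beta>1"
      "norm_on av W \<gamma>0" "norm_on av W \<gamma>1"
    and U: "norm_geodesic_at av U \<alpha>0 \<alpha>1 t \<alpha>"
    and V: "norm_geodesic_at av V \<beta>0 \<beta>1 t \<beta>"
    and W: "norm_geodesic_at av W \<gamma>0 \<gamma>1 t \<gamma>"
    and 0: "\<And>v w. v \<in> carrier V \<Longrightarrow> w \<in> carrier W \<Longrightarrow> \<alpha>0 (B v w) \<le> \<beta>0 v * \<gamma>0 w"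
    and 1: "\<And>v w. v \<in> carrier V \<Longrightarrow> w \<in> carrier W \<Longrightarrow> \<alpha>1 (B v w) \<le> \<beta>1 v * \<gamma>1 w"
    and v: "v \<in> carrier V" and w: "w \<in> carrier W"
  shows "\<alpha> (B v w) \<le> \<beta> v * \<gamma> w"
proof -
  obtain U0 U1 Ut where U: "norm_approx av U U0 \<alpha>0" "norm_approx av U U1 \<alpha>1"
    "\<And>n. diag_geodesic_at av U (U0 n) (U1 n) t (Ut n)"
    "\<And>u. u \<in> carrier U \<Longrightarrow> (\<lambda>n. Ut n u) \<longlonglongrightarrow> \<alpha> u"
    using U unfolding norm_geodesic_at_def by blast
  obtain V0 V1 Vt where V: "norm_approx av V V0 \<beta>0" "norm_approx av V V1 \<beta>1"
    "\<And>n. diag_geodesic_at av V (V0 n) (V1 n) t (Vt n)"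
    "\<And>v. v \<in> carrier V \<Longrightarrow> (\<lambda>n. Vt n v) \<longlonglongrightarrow> \<beta> v"
    using V unfolding norm_geodesic_at_def by blast
  obtain W0 W1 Wt where W: "norm_approx av W W0 \<gamma>0" "norm_approx av W W1 \<gamma>1"
    "\<And>n. diag_geodesic_at av W (W0 n) (W1 n) t (Wt n)"
    "\<And>w. w \<in> carrier W \<Longrightarrow> (\<lambda>n. Wt n w) \<longlonglongrightarrow> \<gamma> w"
    using W unfolding norm_geodesic_at_def by blast
  have bound: "\<alpha> (B v w) \<le> exp (3 * e) * \<beta> v * \<gamma> w" if "0 < e" for e
  proof (rule tendsto_le[OF sequentially_bot])
    show "(\<lambda>n. Ut n (B v w)) \<longlonglongrightarrow> \<alpha> (B v w)"
      using U(4) closed v w by blast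
    show "(\<lambda>n. exp (3 * e) * Vt n v * Wt n w) \<longlonglongrightarrow> exp (3 * e) * \<beta> v * \<gamma> w"
      using V(4) W(4) v w by (intro tendsto_intros) auto
    show "\<forall>\<^sub>F n in sequentially. Ut n (B v w) \<le> exp (3 * e) * Vt n v * Wt n w"
    proof -
      have "\<forall>\<^sub>F n in sequentially. \<forall>v\<in>carrier V. \<forall>w\<in>carrier W.
          U0 n (B v w) \<le> exp (3 * e) * V0 n v * W0 n w"
        by (rule norm_approx_submult[OF U(1) norms(1) V(1) norms(3) W(1) norms(5)]) (use 0 that in auto)
      moreover have "\<forall>\<^sub>F n in sequentially. \<forall>v\<in>carrier V. \<forall>w\<in>carrier W.
          U1 n (B v w) \<le> exp (3 * e) * V1 n v * W1 n w"
        by (rule norm_approx_submult[OF U(2) norms(2) V(2) norms(4) W(2) norms(6)]) (use 1 that in auto)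
      ultimately show ?thesis
      proof eventually_elim
        case (elim n)
        \<comment> \<open>Here \<open>C = exp (3 * e)\<close>: the constant valid at both ends is
          valid at time \<open>t\<close>.\<close>
        show ?case
          by (rule diag_geodesic_at_bound[OF av t exp_gt_zero V(3) W(3) U(3) _ _ v w])
            (use elim in blast)+
      qed
    qed
  qed
  show ?thesis
  \<comment> \<open>One-sided, since \<open>bound\<close> is available for positive \<open>e\<close>
    only.\<close>
  proof (rule tendsto_le[of "at_right 0"])
    have "((\<lambda>e. exp (3 * e) * \<beta> v * \<gamma> w) \<longlongrightarrow> exp (3 * 0) * \<beta> v * \<gamma> w) (at_right 0)"
      by (intro tendsto_intros)
    then show "((\<lambda>e. exp (3 * e) * \<beta> v * \<gamma> w) \<longlongrightarrow> \<beta> v * \<gamma> w) (at_right 0)"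
      by simp
    show "\<forall>\<^sub>F e in at_right 0. \<alpha> (B v w) \<le> exp (3 * e) * \<beta> v * \<gamma> w"
      using bound by (intro eventually_at_right_less[THEN eventually_mono])
  qed auto
qed

text \<open>The form in which every operation on classes is shown to be well defined: if all
  representatives give the same set, and there are representatives, then the union over them is that
  set.\<close>

lemma UN_const_eq:
  assumes "x \<in> A" and "y \<in> B" and "\<And>x y. x \<in> A \<Longrightarrow> y \<in> B \<Longrightarrow> f x y = C"
  shows "(\<Union>x\<in>A. \<Union>y\<in>B. f x y) = C"
  using assms by (auto 4 3)

section \<open>Germs\<close>

text \<open>Treats germs once for both the structure sheaf and the sheaf of modules.\<close>

locale set_sheaf =
  fixes T :: "'x topology" and F :: "'x set \<Rightarrow> 's set" and r
  assumes sheaf: "is_sheaf T F r"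
begin

lemma res_closed:
  "openin T U \<Longrightarrow> openin T V \<Longrightarrow> V \<subseteq> U \<Longrightarrow> s \<in> F U \<Longrightarrow> r U V s \<in> F V"
  using sheaf by (auto simp: is_sheaf_def)

lemma res_id: "openin T U \<Longrightarrow> s \<in> F U \<Longrightarrow> r U U s = s"
  using sheaf by (simp add: is_sheaf_def)

lemma res_res:
  "openin T U \<Longrightarrow> openin T V \<Longrightarrow> openin T W \<Longrightarrow> W \<subseteq> V \<Longrightarrow> V \<subseteq> U \<Longrightarrow> s \<in> F U \<Longrightarrow>
    r V W (r U V s) = r U W s"
  using sheaf by (simp add: is_sheaf_def)

lemma mem_germ: "openin T U \<Longrightarrow> x \<in> U \<Longrightarrow> s \<in> F U \<Longrightarrow> (U, s) \<in> germ T F r x U s"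
  by (auto simp: germ_def)

text \<open>Transitivity of agreeing near \<open>x\<close>: \<open>s\<close> agrees with
  \<open>t\<close> on \<open>W\<close> and with \<open>y\<close> on \<open>W'\<close>, so all three
  agree on the intersection.\<close>

lemma germ_subset:
  assumes "openin T U" "s \<in> F U" "openin T V" "t \<in> F V"
    and W: "openin T W" "x \<in> W" "W \<subseteq> U \<inter> V" "r U W s = r V W t"
  shows "germ T F r x U s \<subseteq> germ T F r x V t"
proof clarify
  fix Y y assume "(Y, y) \<in> germ T F r x U s"
  then obtain W' where Y: "openin T Y" "x \<in> Y" "y \<in> F Y"
    and W': "openin T W'" "x \<in> W'" "W' \<subseteq> U \<inter> Y" "r U W' s = r Y W' y"
    by (auto simp: germ_def)
  let ?W = "W \<inter> W'"
  have o: "openin T ?W"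
    using W W' by (simp add: openin_Int)
  have "r V ?W t = r W ?W (r V W t)"
    using res_res[of V W ?W t] assms o by auto
  also have "\<dots> = r U ?W s"
    using res_res[of U W ?W s] assms o by auto
  also have "\<dots> = r W' ?W (r U W' s)"
    using res_res[of U W' ?W s] assms W' o by auto
  also have "\<dots> = r Y ?W y"
    using res_res[of Y W' ?W y] Y W' o by auto
  finally have "r V ?W t = r Y ?W y" .
  then show "(Y, y) \<in> germ T F r x V t"
    using Y W W' o by (auto simp: germ_def intro!: exI[of _ ?W])
qed

lemma germ_eqI:
  assumes "openin T U" "s \<in> F U" "openin T V" "t \<in> F V"
    and "openin T W" "x \<in> W" "W \<subseteq> U \<inter> V" "r U W s = r V W t"
  shows "germ T F r x U s = germ T F r x V t"
proof (rule equalityI)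
  show "germ T F r x U s \<subseteq> germ T F r x V t"
    using assms by (intro germ_subset)
  show "germ T F r x V t \<subseteq> germ T F r x U s"
    using assms by (intro germ_subset[of V t U s W x]) auto
qed

lemma germ_res:
  assumes "openin T U" "openin T V" "x \<in> V" "V \<subseteq> U" "s \<in> F U"
  shows "germ T F r x V (r U V s) = germ T F r x U s"
  using assms by (intro germ_eqI[of _ _ _ _ V]) (auto simp: res_closed res_id)

end

text \<open>An operation compatible with restriction descends to germs; the left side is the formula
  used in \<open>stalk\<close> and \<open>mstalk\<close>. Three sheaves are allowed because scalar
  multiplication pairs a section of the structure sheaf with one of the module.\<close>

lemma germ_binary_op:
  assumes "set_sheaf T F r" "set_sheaf T F' r'" "set_sheaf T F'' r''"
    and op_closed: "\<And>U s t. openin T U \<Longrightarrow> s \<in> F U \<Longrightarrow> t \<in> F' U \<Longrightarrow> f U s t \<in> F'' U"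
    and op_res: "\<And>U V s t. openin T U \<Longrightarrow> openin T V \<Longrightarrow> V \<subseteq> U \<Longrightarrow> s \<in> F U \<Longrightarrow> t \<in> F' U \<Longrightarrow>
      r'' U V (f U s t) = f V (r U V s) (r' U V t)"
    and W: "openin T W" "x \<in> W" and s: "s \<in> F W" and t: "t \<in> F' W"
  shows "(\<Union>(U, u)\<in>germ T F r x W s. \<Union>(V, v)\<in>germ T F' r' x W t.
      germ T F'' r'' x (U \<inter> V) (f (U \<inter> V) (r U (U \<inter> V) u) (r' V (U \<inter> V) v))) =
    germ T F'' r'' x W (f W s t)"
proof -
  interpret F: set_sheaf T F r by fact
  interpret F': set_sheaf T F' r' by fact
  interpret F'': set_sheaf T F'' r'' by fact
  have "germ T F'' r'' x (U \<inter> V) (f (U \<inter> V) (r U (U \<inter> V) u) (r' V (U \<inter> V) v)) =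
      germ T F'' r'' x W (f W s t)"
    if u: "(U, u) \<in> germ T F r x W s" and v: "(V, v) \<in> germ T F' r' x W t" for U u V v
  proof -
    obtain A where U: "openin T U" "x \<in> U" "u \<in> F U"
      and A: "openin T A" "x \<in> A" "A \<subseteq> W \<inter> U" "r W A s = r U A u"
      using u by (auto simp: germ_def)
    obtain A' where V: "openin T V" "x \<in> V" "v \<in> F' V"
      and A': "openin T A'" "x \<in> A'" "A' \<subseteq> W \<inter> V" "r' W A' t = r' V A' v"
      using v by (auto simp: germ_def)
    \<comment> \<open>\<open>?Y\<close> is where the representatives \<open>u\<close> and
      \<open>v\<close> are combined; \<open>?A\<close> is where they agree with \<open>s\<close> and
      \<open>t\<close>.\<close>
    let ?Y = "U \<inter> V" and ?A = "A \<inter> A'"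
    have o: "openin T ?Y" "openin T ?A"
      using U V A A' by (simp_all add: openin_Int)
    have "r'' ?Y ?A (f ?Y (r U ?Y u) (r' V ?Y v)) = f ?A (r U ?A u) (r' V ?A v)"
    proof -
      have "r ?Y ?A (r U ?Y u) = r U ?A u" "r' ?Y ?A (r' V ?Y v) = r' V ?A v"
        using U V A A' o by (auto intro!: F.res_res F'.res_res)
      then show ?thesis
        using op_res[of ?Y ?A "r U ?Y u" "r' V ?Y v"] U V A A' o
        by (auto simp: F.res_closed F'.res_closed)
    qed
    also have "r U ?A u = r W ?A s"
      using F.res_res[of U A ?A u] F.res_res[of W A ?A s] U A W s o by auto
    also have "r' V ?A v = r' W ?A t"
      using F'.res_res[of V A' ?A v] F'.res_res[of W A' ?A t] V A' W t o by auto
    also have "f ?A (r W ?A s) (r' W ?A t) = r'' W ?A (f W s t)"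
      using op_res[of W ?A s t] W s t A A' o by (metis Int_subset_iff le_infI1)
    finally show ?thesis
      using U V W s t A A' o
      by (intro F''.germ_eqI[of _ _ _ _ ?A]) (auto simp: F.res_closed F'.res_closed op_closed)
  qed
  moreover have "(W, s) \<in> germ T F r x W s" "(W, t) \<in> germ T F' r' x W t"
    using F.mem_germ F'.mem_germ W s t by auto
  ultimately show ?thesis
    unfolding split_beta by (intro UN_const_eq) auto
qed

section \<open>Stalks\<close>

locale sheaf_of_rings =
  fixes S :: "('x, 'r, 'z) rspace_scheme"
  assumes ringed: "ringed_space S"
begin

lemma sec_cring: "openin (utop S) U \<Longrightarrow> cring (sec S U)"
  using ringed by (simp add: ringed_space_def)

lemma res_hom: "openin (utop S) U \<Longrightarrow> openin (utop S) V \<Longrightarrow> V \<subseteq> U \<Longrightarrow> res S U V \<in> ring_hom (sec S U) (sec S V)"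
  using ringed by (simp add: ringed_space_def)

sublocale O: set_sheaf "utop S" "\<lambda>U. carrier (sec S U)" "res S"
  using ringed by unfold_locales (simp add: ringed_space_def)

lemma res_zero:
  assumes "openin (utop S) U" "openin (utop S) V" "V \<subseteq> U"
  shows "res S U V \<zero>\<^bsub>sec S U\<^esub> = \<zero>\<^bsub>sec S V\<^esub>"
  using assms by (intro ring_hom_zero[OF res_hom]) (auto intro: cring.axioms(1) sec_cring)

lemma res_one:
  assumes "openin (utop S) U" "openin (utop S) V" "V \<subseteq> U"
  shows "res S U V \<one>\<^bsub>sec S U\<^esub> = \<one>\<^bsub>sec S V\<^esub>"
  using ring_hom_one[OF res_hom] assms by auto

lemma openin_X: "openin (utop S) (topspace (utop S))"
  by simp

lemma zero_sec: "openin (utop S) U \<Longrightarrow> \<zero>\<^bsub>sec S U\<^esub> \<in> carrier (sec S U)"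
  using cring.cring_simprules(2)[OF sec_cring] .

lemma one_sec: "openin (utop S) U \<Longrightarrow> \<one>\<^bsub>sec S U\<^esub> \<in> carrier (sec S U)"
  using cring.cring_simprules(6)[OF sec_cring] .

lemma rgerm_res:
  assumes "openin (utop S) U" "openin (utop S) V" "x \<in> V" "V \<subseteq> U" "s \<in> carrier (sec S U)"
  shows "rgerm S x V (res S U V s) = rgerm S x U s"
  unfolding rgerm_def by (rule O.germ_res) fact+

lemma rgerm_closed:
  "openin (utop S) U \<Longrightarrow> x \<in> U \<Longrightarrow> s \<in> carrier (sec S U) \<Longrightarrow> rgerm S x U s \<in> carrier (stalk S x)"
  by (auto simp: stalk_def)

text \<open>\<open>stalk\<close> takes the germ of the global zero section. Rewriting it over an
  arbitrary neighbourhood moves computations into a single ring \<open>sec S U\<close>;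
  \<open>stalk_one\<close> serves the same end.\<close>

lemma stalk_zero:
  assumes "openin (utop S) U" "x \<in> U"
  shows "\<zero>\<^bsub>stalk S x\<^esub> = rgerm S x U \<zero>\<^bsub>sec S U\<^esub>"
  using rgerm_res[of "topspace (utop S)" U x "\<zero>\<^bsub>sec S (topspace (utop S))\<^esub>"] assms
  by (simp add: stalk_def res_zero openin_subset zero_sec)

lemma stalk_one:
  assumes "openin (utop S) U" "x \<in> U"
  shows "\<one>\<^bsub>stalk S x\<^esub> = rgerm S x U \<one>\<^bsub>sec S U\<^esub>"
  using rgerm_res[of "topspace (utop S)" U x "\<one>\<^bsub>sec S (topspace (utop S))\<^esub>"] assms
  by (simp add: stalk_def res_one openin_subset one_sec)

lemma stalk_add:
  assumes "openin (utop S) U" "x \<in> U" "s \<in> carrier (sec S U)" "t \<in> carrier (sec S U)"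
  shows "rgerm S x U s \<oplus>\<^bsub>stalk S x\<^esub> rgerm S x U t = rgerm S x U (s \<oplus>\<^bsub>sec S U\<^esub> t)"
proof -
  have closed: "s \<oplus>\<^bsub>sec S U\<^esub> t \<in> carrier (sec S U)"
    if "openin (utop S) U" "s \<in> carrier (sec S U)" "t \<in> carrier (sec S U)" for U s t
    using that by (intro cring.cring_simprules(1)[OF sec_cring])
  show ?thesis
    unfolding stalk_def rgerm_def ring.simps
    by (rule germ_binary_op[where f = "\<lambda>U. add (sec S U)"])
      (use assms O.set_sheaf_axioms closed ring_hom_add[OF res_hom] in auto)
qed

lemma stalk_mult:
  assumes "openin (utop S) U" "x \<in> U" "s \<in> carrier (sec S U)" "t \<in> carrier (sec S U)"
  shows "rgerm S x U s \<otimes>\<^bsub>stalk S x\<^esub> rgerm S x U t = rgerm S x U (s \<otimes>\<^bsub>sec S U\<^esub> t)"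
proof -
  have closed: "s \<otimes>\<^bsub>sec S U\<^esub> t \<in> carrier (sec S U)"
    if "openin (utop S) U" "s \<in> carrier (sec S U)" "t \<in> carrier (sec S U)" for U s t
    using that by (intro cring.cring_simprules(5)[OF sec_cring])
  show ?thesis
    unfolding stalk_def rgerm_def monoid.simps
    by (rule germ_binary_op[where f = "\<lambda>U. monoid.mult (sec S U)"])
      (use assms O.set_sheaf_axioms closed ring_hom_mult[OF res_hom] in auto)
qed

lemma stalk_elem:
  assumes "g \<in> carrier (stalk S x)"
  obtains U s where "openin (utop S) U" "x \<in> U" "s \<in> carrier (sec S U)" "g = rgerm S x U s"
  using assms by (auto simp: stalk_def)

lemma stalk_elem_shrink:
  assumes "g \<in> carrier (stalk S x)" "openin (utop S) V" "x \<in> V"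
  obtains U s where "openin (utop S) U" "x \<in> U" "U \<subseteq> V" "s \<in> carrier (sec S U)" "g = rgerm S x U s"
proof -
  obtain U s where U: "openin (utop S) U" "x \<in> U" "s \<in> carrier (sec S U)" "g = rgerm S x U s"
    using stalk_elem[OF assms(1)] .
  then show ?thesis
    using assms that[of "U \<inter> V" "res S U (U \<inter> V) s"] O.res_closed[of U "U \<inter> V" s]
      rgerm_res[of U "U \<inter> V" x s]
    by (simp add: openin_Int)
qed

text \<open>Each representative is chosen inside the previous neighbourhood and the earlier ones are
  then restricted. Three elements suffice for every ring axiom.\<close>

lemma stalk_elems3:
  assumes "f \<in> carrier (stalk S x)" "g \<in> carrier (stalk S x)" "h \<in> carrier (stalk S x)"
  obtains U a b c where "openin (utop S) U" "x \<in> U" "a \<in> carrier (sec S U)" "b \<in> carrier (sec S U)"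
    "c \<in> carrier (sec S U)" "f = rgerm S x U a" "g = rgerm S x U b" "h = rgerm S x U c"
proof -
  obtain U a where U: "openin (utop S) U" "x \<in> U" "a \<in> carrier (sec S U)" "f = rgerm S x U a"
    using stalk_elem[OF assms(1)] .
  obtain V b where V: "openin (utop S) V" "x \<in> V" "V \<subseteq> U" "b \<in> carrier (sec S V)" "g = rgerm S x V b"
    using stalk_elem_shrink[OF assms(2) U(1,2)] .
  obtain W c where W: "openin (utop S) W" "x \<in> W" "W \<subseteq> V" "c \<in> carrier (sec S W)" "h = rgerm S x W c"
    using stalk_elem_shrink[OF assms(3) V(1,2)] .
  show ?thesis
    using that[of W "res S U W a" "res S V W b" c] U V W
    by (auto simp: O.res_closed rgerm_res)
qed

lemma stalk_cring: "x \<in> topspace (utop S) \<Longrightarrow> cring (stalk S x)"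
proof -
  assume x: "x \<in> topspace (utop S)"
  have add_closed: "f \<oplus>\<^bsub>stalk S x\<^esub> g \<in> carrier (stalk S x)"
    and mult_closed: "f \<otimes>\<^bsub>stalk S x\<^esub> g \<in> carrier (stalk S x)"
    and add_assoc: "f \<oplus>\<^bsub>stalk S x\<^esub> g \<oplus>\<^bsub>stalk S x\<^esub> h = f \<oplus>\<^bsub>stalk S x\<^esub> (g \<oplus>\<^bsub>stalk S x\<^esub> h)"
    and mult_assoc: "f \<otimes>\<^bsub>stalk S x\<^esub> g \<otimes>\<^bsub>stalk S x\<^esub> h = f \<otimes>\<^bsub>stalk S x\<^esub> (g \<otimes>\<^bsub>stalk S x\<^esub> h)"
    and add_comm: "f \<oplus>\<^bsub>stalk S x\<^esub> g = g \<oplus>\<^bsub>stalk S x\<^esub> f"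
    and mult_comm: "f \<otimes>\<^bsub>stalk S x\<^esub> g = g \<otimes>\<^bsub>stalk S x\<^esub> f"
    and distr: "(f \<oplus>\<^bsub>stalk S x\<^esub> g) \<otimes>\<^bsub>stalk S x\<^esub> h =
      f \<otimes>\<^bsub>stalk S x\<^esub> h \<oplus>\<^bsub>stalk S x\<^esub> g \<otimes>\<^bsub>stalk S x\<^esub> h"
    and zero: "\<zero>\<^bsub>stalk S x\<^esub> \<oplus>\<^bsub>stalk S x\<^esub> f = f"
    and one: "\<one>\<^bsub>stalk S x\<^esub> \<otimes>\<^bsub>stalk S x\<^esub> f = f"
    and inv: "\<exists>g\<in>carrier (stalk S x). g \<oplus>\<^bsub>stalk S x\<^esub> f = \<zero>\<^bsub>stalk S x\<^esub>"
    \<comment> \<open>All laws are stated for one triple, so that a common neighbourhood is chosen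
      only once; each law then follows from the corresponding law in \<open>sec S U\<close>.\<close>
    if fgh: "f \<in> carrier (stalk S x)" "g \<in> carrier (stalk S x)" "h \<in> carrier (stalk S x)" for f g h
  proof -
    obtain U a b c where U: "openin (utop S) U" "x \<in> U" and abc: "a \<in> carrier (sec S U)"
      "b \<in> carrier (sec S U)" "c \<in> carrier (sec S U)"
      and eq: "f = rgerm S x U a" "g = rgerm S x U b" "h = rgerm S x U c"
      using stalk_elems3[OF fgh] .
    interpret A: cring "sec S U"
      using U sec_cring by blast
    note simps = eq U abc stalk_add stalk_mult rgerm_closed stalk_zero[OF U] stalk_one[OF U]
    show "f \<oplus>\<^bsub>stalk S x\<^esub> g \<in> carrier (stalk S x)" "f \<otimes>\<^bsub>stalk S x\<^esub> g \<in> carrier (stalk S x)"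
      by (simp_all add: simps)
    show "f \<oplus>\<^bsub>stalk S x\<^esub> g \<oplus>\<^bsub>stalk S x\<^esub> h = f \<oplus>\<^bsub>stalk S x\<^esub> (g \<oplus>\<^bsub>stalk S x\<^esub> h)"
      by (simp add: simps A.a_assoc)
    show "f \<otimes>\<^bsub>stalk S x\<^esub> g \<otimes>\<^bsub>stalk S x\<^esub> h = f \<otimes>\<^bsub>stalk S x\<^esub> (g \<otimes>\<^bsub>stalk S x\<^esub> h)"
      by (simp add: simps A.m_assoc)
    show "f \<oplus>\<^bsub>stalk S x\<^esub> g = g \<oplus>\<^bsub>stalk S x\<^esub> f"
      by (simp add: simps A.a_comm)
    show "f \<otimes>\<^bsub>stalk S x\<^esub> g = g \<otimes>\<^bsub>stalk S x\<^esub> f"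
      by (simp add: simps A.m_comm)
    show "(f \<oplus>\<^bsub>stalk S x\<^esub> g) \<otimes>\<^bsub>stalk S x\<^esub> h =
      f \<otimes>\<^bsub>stalk S x\<^esub> h \<oplus>\<^bsub>stalk S x\<^esub> g \<otimes>\<^bsub>stalk S x\<^esub> h"
      by (simp add: simps A.l_distr)
    show "\<zero>\<^bsub>stalk S x\<^esub> \<oplus>\<^bsub>stalk S x\<^esub> f = f" "\<one>\<^bsub>stalk S x\<^esub> \<otimes>\<^bsub>stalk S x\<^esub> f = f"
      by (simp_all add: simps)
    show "\<exists>g\<in>carrier (stalk S x). g \<oplus>\<^bsub>stalk S x\<^esub> f = \<zero>\<^bsub>stalk S x\<^esub>"
      by (rule bexI[of _ "rgerm S x U (\<ominus>\<^bsub>sec S U\<^esub> a)"]) (simp_all add: simps A.l_neg)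
  qed
  have zero_closed: "\<zero>\<^bsub>stalk S x\<^esub> \<in> carrier (stalk S x)"
    and one_closed: "\<one>\<^bsub>stalk S x\<^esub> \<in> carrier (stalk S x)"
    using x by (simp_all add: stalk_zero[of "topspace (utop S)"] stalk_one[of "topspace (utop S)"] rgerm_closed zero_sec one_sec)
  show ?thesis
    using zero_closed one_closed
    by (intro cringI abelian_groupI comm_monoidI)
      (assumption | rule add_closed mult_closed add_assoc mult_assoc add_comm mult_comm distr zero one inv)+
qed

end

section \<open>Stalks of a sheaf of modules\<close>

locale module_sheaf = sheaf_of_rings S for S :: "('x, 'r, 'z) rspace_scheme" +
  fixes L :: "('x, 'r, 'm) modsheaf"
  assumes sheaf_of_modules: "sheaf_of_modules S L"
begin

sublocale L: set_sheaf "utop S" "\<lambda>U. carrier (msec L U)" "mres L"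
  using sheaf_of_modules by unfold_locales (simp add: sheaf_of_modules_def)

lemma msec_module: "openin (utop S) U \<Longrightarrow> module (sec S U) (msec L U)"
  using sheaf_of_modules by (simp add: sheaf_of_modules_def)

lemma mres_add:
  "openin (utop S) U \<Longrightarrow> openin (utop S) V \<Longrightarrow> V \<subseteq> U \<Longrightarrow> s \<in> carrier (msec L U) \<Longrightarrow> t \<in> carrier (msec L U) \<Longrightarrow>
    mres L U V (s \<oplus>\<^bsub>msec L U\<^esub> t) = mres L U V s \<oplus>\<^bsub>msec L V\<^esub> mres L U V t"
  using sheaf_of_modules by (simp add: sheaf_of_modules_def)

lemma mres_smult:
  "openin (utop S) U \<Longrightarrow> openin (utop S) V \<Longrightarrow> V \<subseteq> U \<Longrightarrow> a \<in> carrier (sec S U) \<Longrightarrow> s \<in> carrier (msec L U) \<Longrightarrow>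
    mres L U V (a \<odot>\<^bsub>msec L U\<^esub> s) = res S U V a \<odot>\<^bsub>msec L V\<^esub> mres L U V s"
  using sheaf_of_modules by (simp add: sheaf_of_modules_def)

lemma zero_msec: "openin (utop S) U \<Longrightarrow> \<zero>\<^bsub>msec L U\<^esub> \<in> carrier (msec L U)"
  using abelian_groupE(2)[OF module.axioms(2)[OF msec_module]] .

text \<open>\<open>sheaf_of_modules\<close> records additivity and compatibility with scalars; zero
  is reached by writing it as the zero scalar times zero.\<close>

lemma mres_zero:
  assumes "openin (utop S) U" "openin (utop S) V" "V \<subseteq> U"
  shows "mres L U V \<zero>\<^bsub>msec L U\<^esub> = \<zero>\<^bsub>msec L V\<^esub>"
proof -
  interpret U: module "sec S U" "msec L U" using assms msec_module by blast
  interpret V: module "sec S V" "msec L V" using assms msec_module by blast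
  have "mres L U V \<zero>\<^bsub>msec L U\<^esub> = mres L U V (\<zero>\<^bsub>sec S U\<^esub> \<odot>\<^bsub>msec L U\<^esub> \<zero>\<^bsub>msec L U\<^esub>)"
    by simp
  also have "\<dots> = \<zero>\<^bsub>sec S V\<^esub> \<odot>\<^bsub>msec L V\<^esub> mres L U V \<zero>\<^bsub>msec L U\<^esub>"
    \<comment> \<open>The two null laws would undo the rewriting that prepares
      \<open>mres_smult\<close>.\<close>
    using assms by (simp del: U.smult_r_null U.smult_l_null add: mres_smult res_zero)
  also have "\<dots> = \<zero>\<^bsub>msec L V\<^esub>"
    using assms L.res_closed[of U V] by simp
  finally show ?thesis .
qed

lemma mgerm_res:
  assumes "openin (utop S) U" "openin (utop S) V" "x \<in> V" "V \<subseteq> U" "s \<in> carrier (msec L U)"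
  shows "mgerm S L x V (mres L U V s) = mgerm S L x U s"
  unfolding mgerm_def by (rule L.germ_res) fact+

lemma mgerm_closed:
  "openin (utop S) U \<Longrightarrow> x \<in> U \<Longrightarrow> s \<in> carrier (msec L U) \<Longrightarrow> mgerm S L x U s \<in> carrier (mstalk S L x)"
  by (auto simp: mstalk_def)

lemma mstalk_zero:
  assumes "openin (utop S) U" "x \<in> U"
  shows "\<zero>\<^bsub>mstalk S L x\<^esub> = mgerm S L x U \<zero>\<^bsub>msec L U\<^esub>"
  using mgerm_res[of "topspace (utop S)" U x "\<zero>\<^bsub>msec L (topspace (utop S))\<^esub>"] assms
  by (simp add: mstalk_def mres_zero openin_subset zero_msec)

lemma mstalk_add:
  assumes "openin (utop S) U" "x \<in> U" "s \<in> carrier (msec L U)" "t \<in> carrier (msec L U)"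
  shows "mgerm S L x U s \<oplus>\<^bsub>mstalk S L x\<^esub> mgerm S L x U t = mgerm S L x U (s \<oplus>\<^bsub>msec L U\<^esub> t)"
proof -
  have closed: "s \<oplus>\<^bsub>msec L U\<^esub> t \<in> carrier (msec L U)"
    if "openin (utop S) U" "s \<in> carrier (msec L U)" "t \<in> carrier (msec L U)" for U s t
    using that by (intro abelian_groupE(1)[OF module.axioms(2)[OF msec_module]])
  show ?thesis
    unfolding mstalk_def mgerm_def ring.simps
    by (rule germ_binary_op[where f = "\<lambda>U. add (msec L U)"])
      (use assms L.set_sheaf_axioms closed mres_add in auto)
qed

lemma mstalk_smult:
  assumes "openin (utop S) U" "x \<in> U" "a \<in> carrier (sec S U)" "t \<in> carrier (msec L U)"
  shows "rgerm S x U a \<odot>\<^bsub>mstalk S L x\<^esub> mgerm S L x U t = mgerm S L x U (a \<odot>\<^bsub>msec L U\<^esub> t)"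
proof -
  have closed: "a \<odot>\<^bsub>msec L U\<^esub> t \<in> carrier (msec L U)"
    if "openin (utop S) U" "a \<in> carrier (sec S U)" "t \<in> carrier (msec L U)" for U a t
    using that by (intro module.smult_closed[OF msec_module])
  show ?thesis
    unfolding mstalk_def mgerm_def rgerm_def module.simps
    by (rule germ_binary_op[where f = "\<lambda>U. smult (msec L U)"])
      (use assms L.set_sheaf_axioms O.set_sheaf_axioms closed mres_smult in auto)
qed

lemma mstalk_elem:
  assumes "g \<in> carrier (mstalk S L x)"
  obtains U s where "openin (utop S) U" "x \<in> U" "s \<in> carrier (msec L U)" "g = mgerm S L x U s"
  using assms by (auto simp: mstalk_def)

lemma mstalk_elem_shrink:
  assumes "g \<in> carrier (mstalk S L x)" "openin (utop S) V" "x \<in> V"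
  obtains U s where "openin (utop S) U" "x \<in> U" "U \<subseteq> V" "s \<in> carrier (msec L U)" "g = mgerm S L x U s"
proof -
  obtain U s where U: "openin (utop S) U" "x \<in> U" "s \<in> carrier (msec L U)" "g = mgerm S L x U s"
    using mstalk_elem[OF assms(1)] .
  then show ?thesis
    using assms that[of "U \<inter> V" "mres L U (U \<inter> V) s"] L.res_closed[of U "U \<inter> V" s]
      mgerm_res[of U "U \<inter> V" x s]
    by (simp add: openin_Int)
qed

text \<open>The set \<open>Y\<close> lets the choice continue inside a neighbourhood on which
  scalars are already represented.\<close>

lemma mstalk_elems2:
  assumes "f \<in> carrier (mstalk S L x)" "g \<in> carrier (mstalk S L x)" "openin (utop S) Y" "x \<in> Y"
  obtains U a b where "openin (utop S) U" "x \<in> U" "U \<subseteq> Y" "a \<in> carrier (msec L U)" "b \<in> carrier (msec L U)"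
    "f = mgerm S L x U a" "g = mgerm S L x U b"
proof -
  obtain U a where U: "openin (utop S) U" "x \<in> U" "U \<subseteq> Y" "a \<in> carrier (msec L U)" "f = mgerm S L x U a"
    using mstalk_elem_shrink[OF assms(1,3,4)] .
  obtain V b where V: "openin (utop S) V" "x \<in> V" "V \<subseteq> U" "b \<in> carrier (msec L V)" "g = mgerm S L x V b"
    using mstalk_elem_shrink[OF assms(2) U(1,2)] .
  show ?thesis
    using that[of V "mres L U V a" b] U V by (auto simp: L.res_closed mgerm_res)
qed

lemma mstalk_module: "x \<in> topspace (utop S) \<Longrightarrow> module (stalk S x) (mstalk S L x)"
proof -
  let ?M = "mstalk S L x" and ?A = "stalk S x"
  assume x: "x \<in> topspace (utop S)"
  have add_closed: "f \<oplus>\<^bsub>?M\<^esub> g \<in> carrier ?M"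
    and add_assoc: "f \<oplus>\<^bsub>?M\<^esub> g \<oplus>\<^bsub>?M\<^esub> h = f \<oplus>\<^bsub>?M\<^esub> (g \<oplus>\<^bsub>?M\<^esub> h)"
    and add_comm: "f \<oplus>\<^bsub>?M\<^esub> g = g \<oplus>\<^bsub>?M\<^esub> f"
    and zero: "\<zero>\<^bsub>?M\<^esub> \<oplus>\<^bsub>?M\<^esub> f = f"
    and inv: "\<exists>g\<in>carrier ?M. g \<oplus>\<^bsub>?M\<^esub> f = \<zero>\<^bsub>?M\<^esub>"
    if fgh: "f \<in> carrier ?M" "g \<in> carrier ?M" "h \<in> carrier ?M" for f g h
  proof -
    obtain U b c where U: "openin (utop S) U" "x \<in> U" and bc: "b \<in> carrier (msec L U)" "c \<in> carrier (msec L U)"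
      and eq: "g = mgerm S L x U b" "h = mgerm S L x U c"
      using mstalk_elems2[OF fgh(2,3) openin_X x] by metis
    obtain V a where V: "openin (utop S) V" "x \<in> V" "V \<subseteq> U" and a: "a \<in> carrier (msec L V)"
      and eqf: "f = mgerm S L x V a"
      using mstalk_elem_shrink[OF fgh(1) U] .
    define b' c' where "b' = mres L U V b" and "c' = mres L U V c"
    have eq': "g = mgerm S L x V b'" "h = mgerm S L x V c'"
      using eq bc U V by (simp_all add: b'_def c'_def mgerm_res)
    have bc': "b' \<in> carrier (msec L V)" "c' \<in> carrier (msec L V)"
      using bc U V by (simp_all add: b'_def c'_def L.res_closed)
    interpret M: module "sec S V" "msec L V"
      using V msec_module by blast
    note simps = eqf eq' V a bc' mstalk_add mgerm_closed mstalk_zero[OF V(1,2)]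
    show "f \<oplus>\<^bsub>?M\<^esub> g \<in> carrier ?M" "\<zero>\<^bsub>?M\<^esub> \<oplus>\<^bsub>?M\<^esub> f = f"
      by (simp_all add: simps)
    show "f \<oplus>\<^bsub>?M\<^esub> g \<oplus>\<^bsub>?M\<^esub> h = f \<oplus>\<^bsub>?M\<^esub> (g \<oplus>\<^bsub>?M\<^esub> h)"
      by (simp add: simps M.M.a_assoc)
    show "f \<oplus>\<^bsub>?M\<^esub> g = g \<oplus>\<^bsub>?M\<^esub> f"
      by (simp add: simps M.M.a_comm)
    show "\<exists>g\<in>carrier ?M. g \<oplus>\<^bsub>?M\<^esub> f = \<zero>\<^bsub>?M\<^esub>"
      by (rule bexI[of _ "mgerm S L x V (\<ominus>\<^bsub>msec L V\<^esub> a)"]) (simp_all add: simps M.M.l_neg)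
  qed
  have smult_closed: "p \<odot>\<^bsub>?M\<^esub> f \<in> carrier ?M"
    and l_distr: "(p \<oplus>\<^bsub>?A\<^esub> q) \<odot>\<^bsub>?M\<^esub> f = p \<odot>\<^bsub>?M\<^esub> f \<oplus>\<^bsub>?M\<^esub> q \<odot>\<^bsub>?M\<^esub> f"
    and r_distr: "p \<odot>\<^bsub>?M\<^esub> (f \<oplus>\<^bsub>?M\<^esub> g) = p \<odot>\<^bsub>?M\<^esub> f \<oplus>\<^bsub>?M\<^esub> p \<odot>\<^bsub>?M\<^esub> g"
    and assoc: "(p \<otimes>\<^bsub>?A\<^esub> q) \<odot>\<^bsub>?M\<^esub> f = p \<odot>\<^bsub>?M\<^esub> (q \<odot>\<^bsub>?M\<^esub> f)"
    and one: "\<one>\<^bsub>?A\<^esub> \<odot>\<^bsub>?M\<^esub> f = f"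
    if pq: "p \<in> carrier ?A" "q \<in> carrier ?A" and fg: "f \<in> carrier ?M" "g \<in> carrier ?M" for p q f g
  proof -
    obtain U a b where U: "openin (utop S) U" "x \<in> U" and ab: "a \<in> carrier (sec S U)" "b \<in> carrier (sec S U)"
      and eq: "p = rgerm S x U a" "q = rgerm S x U b"
      using stalk_elems3[OF pq pq(2)] by metis
    obtain V s t where V: "openin (utop S) V" "x \<in> V" "V \<subseteq> U"
      and st: "s \<in> carrier (msec L V)" "t \<in> carrier (msec L V)"
      and eqf: "f = mgerm S L x V s" "g = mgerm S L x V t"
      using mstalk_elems2[OF fg U] .
    \<comment> \<open>The scalars live on the larger set \<open>U\<close>; restricted to
      \<open>V\<close>, they meet the vectors in one module \<open>msec L V\<close>.\<close>
    define a' b' where "a' = res S U V a" and "b' = res S U V b"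
    have eq': "p = rgerm S x V a'" "q = rgerm S x V b'"
      using eq ab U V by (simp_all add: a'_def b'_def rgerm_res)
    have ab': "a' \<in> carrier (sec S V)" "b' \<in> carrier (sec S V)"
      using ab U V by (simp_all add: a'_def b'_def O.res_closed)
    interpret M: module "sec S V" "msec L V"
      using V msec_module by blast
    note simps = eqf eq' V ab' st mstalk_add mstalk_smult mgerm_closed stalk_add stalk_mult
      stalk_one[OF V(1,2)]
    show "p \<odot>\<^bsub>?M\<^esub> f \<in> carrier ?M" "\<one>\<^bsub>?A\<^esub> \<odot>\<^bsub>?M\<^esub> f = f"
      by (simp_all add: simps)
    show "(p \<oplus>\<^bsub>?A\<^esub> q) \<odot>\<^bsub>?M\<^esub> f = p \<odot>\<^bsub>?M\<^esub> f \<oplus>\<^bsub>?M\<^esub> q \<odot>\<^bsub>?M\<^esub> f"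
      by (simp add: simps M.smult_l_distr)
    show "p \<odot>\<^bsub>?M\<^esub> (f \<oplus>\<^bsub>?M\<^esub> g) = p \<odot>\<^bsub>?M\<^esub> f \<oplus>\<^bsub>?M\<^esub> p \<odot>\<^bsub>?M\<^esub> g"
      by (simp add: simps M.smult_r_distr)
    show "(p \<otimes>\<^bsub>?A\<^esub> q) \<odot>\<^bsub>?M\<^esub> f = p \<odot>\<^bsub>?M\<^esub> (q \<odot>\<^bsub>?M\<^esub> f)"
      by (simp add: simps M.smult_assoc1)
  qed
  have zero_closed: "\<zero>\<^bsub>?M\<^esub> \<in> carrier ?M" and one_closed: "\<one>\<^bsub>?A\<^esub> \<in> carrier ?A"
    using x by (simp_all add: mstalk_zero[of "topspace (utop S)"] mgerm_closed zero_msec stalk_one[of "topspace (utop S)"] rgerm_closed one_sec)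
  show ?thesis
    using zero_closed one_closed
    by (intro moduleI abelian_groupI stalk_cring[OF x])
      (assumption | rule add_closed add_assoc add_comm zero inv smult_closed l_distr r_distr assoc one)+
qed

end

section \<open>Tensor powers\<close>

lemma ftensors_Nil [simp]: "[] \<in> ftensors A M k"
  by (simp add: ftensors_def)

lemma ftensors_Cons [simp]:
  "(a, xs) # u \<in> ftensors A M k \<longleftrightarrow>
    a \<in> carrier A \<and> length xs = k \<and> set xs \<subseteq> carrier M \<and> u \<in> ftensors A M k"
  by (auto simp: ftensors_def)

lemma ftensors_append [simp]:
  "u @ v \<in> ftensors A M k \<longleftrightarrow> u \<in> ftensors A M k \<and> v \<in> ftensors A M k"
  by (auto simp: ftensors_def)

text \<open>Distributivity over lists produces the right terms in interleaved order; exchanging the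
  two middle blocks sorts them.\<close>

lemma tensor_eq_swap:
  assumes "u \<in> ftensors A M k" "v \<in> ftensors A M k" "w \<in> ftensors A M k" "z \<in> ftensors A M k"
  shows "tensor_eq A M k (u @ v @ w @ z) (u @ w @ v @ z)"
proof -
  have "tensor_eq A M k ((v @ w) @ z) ((w @ v) @ z)"
    using assms by (intro tensor_eq.append tensor_eq.commute tensor_eq.refl)
  from tensor_eq.append[OF tensor_eq.refl[OF assms(1)] this] show ?thesis
    by simp
qed

lemma tensor_class_eqI: "tensor_eq A M k u v \<Longrightarrow> tensor_class A M k u = tensor_class A M k v"
  by (auto simp: tensor_class_def intro: tensor_eq.sym tensor_eq.trans)

lemma tensor_class_self: "u \<in> ftensors A M k \<Longrightarrow> u \<in> tensor_class A M k u"
  by (simp add: tensor_class_def tensor_eq.refl)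

text \<open>Names the scaling of representatives that occurs inline in
  \<open>tensor_power\<close>.\<close>

definition ftensor_smult ::
  "('r, 'z) ring_scheme \<Rightarrow> 'r \<Rightarrow> ('r, 'm) ftensor \<Rightarrow> ('r, 'm) ftensor" where
  "ftensor_smult A a u = map (\<lambda>(b, xs). (a \<otimes>\<^bsub>A\<^esub> b, xs)) u"

lemma ftensor_smult_simps [simp]:
  "ftensor_smult A a [] = []"
  "ftensor_smult A a ((b, xs) # u) = (a \<otimes>\<^bsub>A\<^esub> b, xs) # ftensor_smult A a u"
  "ftensor_smult A a (u @ v) = ftensor_smult A a u @ ftensor_smult A a v"
  by (simp_all add: ftensor_smult_def)

lemma ftensor_mult_simps [simp]:
  "ftensor_mult A [] v = []"
  "ftensor_mult A ((a, xs) # u) v = map (\<lambda>(b, ys). (a \<otimes>\<^bsub>A\<^esub> b, xs @ ys)) v @ ftensor_mult A u v"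
  "ftensor_mult A (u @ u') v = ftensor_mult A u v @ ftensor_mult A u' v"
  by (simp_all add: ftensor_mult_def)

lemma ftensor_mult_Nil_right [simp]: "ftensor_mult A u [] = []"
  by (induction u) (auto simp: ftensor_mult_def)

lemma tensor_power_carrier: "carrier (tensor_power A M k) = tensor_class A M k ` ftensors A M k"
  by (simp add: tensor_power_def)

lemma tensor_power_zero: "\<zero>\<^bsub>tensor_power A M k\<^esub> = tensor_class A M k []"
  by (simp add: tensor_power_def)

lemma tensor_class_closed: "u \<in> ftensors A M k \<Longrightarrow> tensor_class A M k u \<in> carrier (tensor_power A M k)"
  by (simp add: tensor_power_carrier)

lemma tensor_power_add:
  assumes "u \<in> ftensors A M k" "v \<in> ftensors A M k"
  shows "tensor_class A M k u \<oplus>\<^bsub>tensor_power A M k\<^esub> tensor_class A M k v = tensor_class A M k (u @ v)"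
  unfolding tensor_power_def ring.simps
proof (rule UN_const_eq)
  fix u' v' assume "u' \<in> tensor_class A M k u" "v' \<in> tensor_class A M k v"
  then show "tensor_class A M k (u' @ v') = tensor_class A M k (u @ v)"
    by (intro tensor_class_eqI tensor_eq.append) (auto simp: tensor_class_def intro: tensor_eq.sym)
qed (use assms in \<open>auto intro: tensor_class_self\<close>)

lemma tensor_power_elem:
  assumes "c \<in> carrier (tensor_power A M k)"
  obtains u where "u \<in> ftensors A M k" "c = tensor_class A M k u"
  using assms by (auto simp: tensor_power_carrier)

text \<open>Instantiated twice below: with the stalks at a point, and with the sections over an open
  set.\<close>

locale base_module = module R M
  for R :: "('r, 'z) ring_scheme" (structure) and M :: "('r, 'm) module" (structure)
begin

lemma tensor_eq_ftensors:
  "tensor_eq R M k u v \<Longrightarrow> u \<in> ftensors R M k \<and> v \<in> ftensors R M k"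
  by (induction rule: tensor_eq.induct) auto

lemma ftensor_smult_closed [simp]:
  "a \<in> carrier R \<Longrightarrow> u \<in> ftensors R M k \<Longrightarrow> ftensor_smult R a u \<in> ftensors R M k"
  by (induction u) auto

lemma ftensor_smult_one: "u \<in> ftensors R M k \<Longrightarrow> ftensor_smult R \<one> u = u"
  by (induction u) auto

lemma ftensor_smult_assoc:
  "a \<in> carrier R \<Longrightarrow> b \<in> carrier R \<Longrightarrow> u \<in> ftensors R M k \<Longrightarrow>
    ftensor_smult R (a \<otimes> b) u = ftensor_smult R a (ftensor_smult R b u)"
  by (induction u) (auto simp: m_assoc)

text \<open>Scaling maps each generating relation to another instance of it, by distributivity and
  associativity of the coefficient ring.\<close>

lemma tensor_eq_smult:
  assumes a: "a \<in> carrier R"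
  shows "tensor_eq R M k u v \<Longrightarrow> tensor_eq R M k (ftensor_smult R a u) (ftensor_smult R a v)"
proof (induction rule: tensor_eq.induct)
  case (zero_coeff xs)
  then show ?case
    using a by (auto intro: tensor_eq.zero_coeff)
next
  case (add_coeff p xs q)
  then show ?case
    using a tensor_eq.add_coeff[of "a \<otimes> p" xs "a \<otimes> q" R M k] by (auto simp: r_distr)
next
  case (add_slot p xs x ys y)
  then show ?case
    using a tensor_eq.add_slot[of "a \<otimes> p" xs x ys y R M k] by auto
next
  case (smult_slot p xs x ys b)
  then show ?case
    using a tensor_eq.smult_slot[of "a \<otimes> p" xs x ys R M k b] by (auto simp: m_assoc)
qed (use a in \<open>auto intro: tensor_eq.refl tensor_eq.sym tensor_eq.trans tensor_eq.append tensor_eq.commute\<close>)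

text \<open>An equivalence and not an equality of lists: \<open>add_coeff\<close> splits each term
  in place, so the two scalings come out alternating and have to be separated.\<close>

lemma ftensor_smult_add:
  assumes "a \<in> carrier R" "b \<in> carrier R"
  shows "u \<in> ftensors R M k \<Longrightarrow>
    tensor_eq R M k (ftensor_smult R (a \<oplus> b) u) (ftensor_smult R a u @ ftensor_smult R b u)"
proof (induction u)
  case Nil
  then show ?case
    by (auto intro: tensor_eq.refl)
next
  case (Cons p u)
  obtain c xs where p: "p = (c, xs)"
    by (cases p)
  have "tensor_eq R M k [((a \<oplus> b) \<otimes> c, xs)] [(a \<otimes> c, xs), (b \<otimes> c, xs)]"
    using Cons.prems assms tensor_eq.add_coeff[of "a \<otimes> c" xs "b \<otimes> c" R M k]
    by (simp add: p l_distr)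
  then have "tensor_eq R M k ([((a \<oplus> b) \<otimes> c, xs)] @ ftensor_smult R (a \<oplus> b) u)
      ([(a \<otimes> c, xs), (b \<otimes> c, xs)] @ (ftensor_smult R a u @ ftensor_smult R b u))"
    using Cons by (intro tensor_eq.append) (auto simp: p)
  also have "tensor_eq R M k \<dots>
      ([(a \<otimes> c, xs)] @ ftensor_smult R a u @ [(b \<otimes> c, xs)] @ ftensor_smult R b u)"
    using Cons.prems assms tensor_eq_swap[of "[(a \<otimes> c, xs)]" R M k "[(b \<otimes> c, xs)]"
        "ftensor_smult R a u" "ftensor_smult R b u"]
    by (simp add: p)
  finally (tensor_eq.trans) show ?case
    by (simp add: p)
qed

lemma ftensor_smult_zero:
  "u \<in> ftensors R M k \<Longrightarrow> tensor_eq R M k (ftensor_smult R \<zero> u) []"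
proof (induction u)
  case Nil
  then show ?case
    by (auto intro: tensor_eq.refl)
next
  case (Cons p u)
  obtain c xs where p: "p = (c, xs)"
    by (cases p)
  have "tensor_eq R M k ([(\<zero> \<otimes> c, xs)] @ ftensor_smult R \<zero> u) ([] @ [])"
    using Cons by (intro tensor_eq.append) (auto simp: p intro: tensor_eq.zero_coeff)
  then show ?case
    by (simp add: p)
qed

lemma tensor_power_smult:
  assumes "a \<in> carrier R" "u \<in> ftensors R M k"
  shows "a \<odot>\<^bsub>tensor_power R M k\<^esub> tensor_class R M k u = tensor_class R M k (ftensor_smult R a u)"
proof -
  have "tensor_class R M k (ftensor_smult R a u') = tensor_class R M k (ftensor_smult R a u)"
    if "u' \<in> tensor_class R M k u" for u'
    using that assms by (intro tensor_class_eqI tensor_eq_smult) (auto simp: tensor_class_def intro: tensor_eq.sym)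
  then show ?thesis
    unfolding tensor_power_def module.simps ftensor_smult_def[symmetric]
    using tensor_class_self[OF assms(2)] by (intro SUP_eq_const) blast+
qed

text \<open>Most axioms are equalities of lists on representatives. The relation
  \<open>tensor_eq\<close> itself is needed for commutativity, additive inverses and distributivity
  over a sum of scalars.\<close>

lemma tensor_power_module: "module R (tensor_power R M k)"
proof -
  let ?P = "tensor_power R M k"
  have add_closed: "c \<oplus>\<^bsub>?P\<^esub> d \<in> carrier ?P"
    and add_assoc: "c \<oplus>\<^bsub>?P\<^esub> d \<oplus>\<^bsub>?P\<^esub> e = c \<oplus>\<^bsub>?P\<^esub> (d \<oplus>\<^bsub>?P\<^esub> e)"
    and add_comm: "c \<oplus>\<^bsub>?P\<^esub> d = d \<oplus>\<^bsub>?P\<^esub> c"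
    and zero: "\<zero>\<^bsub>?P\<^esub> \<oplus>\<^bsub>?P\<^esub> c = c"
    and inv: "\<exists>d\<in>carrier ?P. d \<oplus>\<^bsub>?P\<^esub> c = \<zero>\<^bsub>?P\<^esub>"
    and smult_closed: "a \<in> carrier R \<Longrightarrow> a \<odot>\<^bsub>?P\<^esub> c \<in> carrier ?P"
    and l_distr: "a \<in> carrier R \<Longrightarrow> b \<in> carrier R \<Longrightarrow>
      (a \<oplus> b) \<odot>\<^bsub>?P\<^esub> c = a \<odot>\<^bsub>?P\<^esub> c \<oplus>\<^bsub>?P\<^esub> b \<odot>\<^bsub>?P\<^esub> c"
    and r_distr: "a \<in> carrier R \<Longrightarrow> a \<odot>\<^bsub>?P\<^esub> (c \<oplus>\<^bsub>?P\<^esub> d) = a \<odot>\<^bsub>?P\<^esub> c \<oplus>\<^bsub>?P\<^esub> a \<odot>\<^bsub>?P\<^esub> d"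
    and assoc: "a \<in> carrier R \<Longrightarrow> b \<in> carrier R \<Longrightarrow> (a \<otimes> b) \<odot>\<^bsub>?P\<^esub> c = a \<odot>\<^bsub>?P\<^esub> (b \<odot>\<^bsub>?P\<^esub> c)"
    and one: "\<one> \<odot>\<^bsub>?P\<^esub> c = c"
    if cde: "c \<in> carrier ?P" "d \<in> carrier ?P" "e \<in> carrier ?P" for c d e a b
  proof -
    obtain u v w where uvw: "u \<in> ftensors R M k" "v \<in> ftensors R M k" "w \<in> ftensors R M k"
      and eq: "c = tensor_class R M k u" "d = tensor_class R M k v" "e = tensor_class R M k w"
      using cde by (elim tensor_power_elem)
    note simps = eq uvw tensor_power_add tensor_power_smult tensor_power_zero tensor_class_closed
    show "c \<oplus>\<^bsub>?P\<^esub> d \<in> carrier ?P" "c \<oplus>\<^bsub>?P\<^esub> d \<oplus>\<^bsub>?P\<^esub> e = c \<oplus>\<^bsub>?P\<^esub> (d \<oplus>\<^bsub>?P\<^esub> e)"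
      "\<zero>\<^bsub>?P\<^esub> \<oplus>\<^bsub>?P\<^esub> c = c" "\<one> \<odot>\<^bsub>?P\<^esub> c = c"
      by (simp_all add: simps ftensor_smult_one[OF uvw(1)])
    show "c \<oplus>\<^bsub>?P\<^esub> d = d \<oplus>\<^bsub>?P\<^esub> c"
      using tensor_class_eqI[OF tensor_eq.commute[OF uvw(1,2)]] by (simp add: simps)
    \<comment> \<open>No generating relation mentions negatives; the inverse is
      \<open>\<ominus> \<one>\<close> times \<open>u\<close>, as the scalars
      \<open>\<ominus> \<one>\<close> and \<open>\<one>\<close> add up to zero.\<close>
    have "tensor_eq R M k (ftensor_smult R (\<ominus> \<one>) u @ u) []"
    proof -
      have "tensor_eq R M k (ftensor_smult R (\<ominus> \<one>) u @ u) (ftensor_smult R (\<ominus> \<one> \<oplus> \<one>) u)"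
        using uvw ftensor_smult_add[of "\<ominus> \<one>" \<one> u k] by (simp add: ftensor_smult_one tensor_eq.sym)
      also have "tensor_eq R M k (ftensor_smult R (\<ominus> \<one> \<oplus> \<one>) u) []"
        using uvw ftensor_smult_zero by (simp add: R.l_neg)
      finally (tensor_eq.trans) show ?thesis .
    qed
    then show "\<exists>d\<in>carrier ?P. d \<oplus>\<^bsub>?P\<^esub> c = \<zero>\<^bsub>?P\<^esub>"
      using uvw by (intro bexI[of _ "tensor_class R M k (ftensor_smult R (\<ominus> \<one>) u)"])
        (simp_all add: simps tensor_class_eqI)
    show "a \<in> carrier R \<Longrightarrow> a \<odot>\<^bsub>?P\<^esub> c \<in> carrier ?P"
      "a \<in> carrier R \<Longrightarrow> a \<odot>\<^bsub>?P\<^esub> (c \<oplus>\<^bsub>?P\<^esub> d) = a \<odot>\<^bsub>?P\<^esub> c \<oplus>\<^bsub>?P\<^esub> a \<odot>\<^bsub>?P\<^esub> d"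
      "a \<in> carrier R \<Longrightarrow> b \<in> carrier R \<Longrightarrow> (a \<otimes> b) \<odot>\<^bsub>?P\<^esub> c = a \<odot>\<^bsub>?P\<^esub> (b \<odot>\<^bsub>?P\<^esub> c)"
      by (simp_all add: simps ftensor_smult_assoc[OF _ _ uvw(1)])
    show "a \<in> carrier R \<Longrightarrow> b \<in> carrier R \<Longrightarrow>
      (a \<oplus> b) \<odot>\<^bsub>?P\<^esub> c = a \<odot>\<^bsub>?P\<^esub> c \<oplus>\<^bsub>?P\<^esub> b \<odot>\<^bsub>?P\<^esub> c"
      using tensor_class_eqI[OF ftensor_smult_add[OF _ _ uvw(1)]] by (simp add: simps)
  qed
  have zero_closed: "\<zero>\<^bsub>?P\<^esub> \<in> carrier ?P"
    by (simp add: tensor_power_zero tensor_class_closed)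
  show ?thesis
  proof (rule moduleI)
    show "abelian_group ?P"
      using zero_closed by (intro abelian_groupI) (assumption | rule add_closed add_assoc add_comm zero inv)+
  qed (assumption | rule R.is_cring smult_closed l_distr r_distr assoc one)+
qed

section \<open>Multiplication of tensors\<close>

lemma ftensor_mult_closed:
  "u \<in> ftensors R M k \<Longrightarrow> v \<in> ftensors R M l \<Longrightarrow> ftensor_mult R u v \<in> ftensors R M (k + l)"
  unfolding ftensors_def ftensor_mult_def lists_eq_set by force

text \<open>In \<open>ftensor_mult\<close> the left factor is the outer loop. Additivity on the left
  is therefore an equality of lists, whereas on the right the terms must be reordered.\<close>

lemma ftensor_mult_append_right:
  assumes "v \<in> ftensors R M l" "w \<in> ftensors R M l"
  shows "u \<in> ftensors R M k \<Longrightarrow>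
    tensor_eq R M (k + l) (ftensor_mult R u (v @ w)) (ftensor_mult R u v @ ftensor_mult R u w)"
proof (induction u)
  case Nil
  then show ?case
    by (auto intro: tensor_eq.refl)
next
  case (Cons p u)
  let ?m = "ftensor_mult R"
  have closed: "?m [p] v \<in> ftensors R M (k + l)" "?m [p] w \<in> ftensors R M (k + l)"
    "?m u v \<in> ftensors R M (k + l)" "?m u w \<in> ftensors R M (k + l)"
    using Cons.prems assms by (cases p; auto intro!: ftensor_mult_closed simp del: ftensor_mult_simps)+
  have "tensor_eq R M (k + l) ((?m [p] v @ ?m [p] w) @ ?m u (v @ w))
      ((?m [p] v @ ?m [p] w) @ ?m u v @ ?m u w)"
    using Cons closed by (intro tensor_eq.append tensor_eq.refl) (cases p; auto)+
  also have "tensor_eq R M (k + l) \<dots> (?m [p] v @ ?m u v @ ?m [p] w @ ?m u w)"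
    using tensor_eq_swap[of "?m [p] v" R M "k + l" "?m [p] w" "?m u v" "?m u w"] closed by simp
  finally (tensor_eq.trans) show ?case
    by (cases p) simp
qed

text \<open>Induction on \<open>u\<close> reduces to a single term \<open>(a, xs)\<close>.
  Multiplying by it on the left prefixes all slots with \<open>xs\<close>, which turns each
  generating relation into an instance of itself in degree \<open>k + l\<close>.\<close>

lemma tensor_eq_mult_right:
  assumes "u \<in> ftensors R M k" and vv': "tensor_eq R M l v v'"
  shows "tensor_eq R M (k + l) (ftensor_mult R u v) (ftensor_mult R u v')"
  using assms(1)
proof (induction u)
  case Nil
  then show ?case
    by (auto intro: tensor_eq.refl)
next
  case (Cons p u)
  obtain a xs where p: "p = (a, xs)"
    by (cases p)
  have a: "a \<in> carrier R" "length xs = k" "set xs \<subseteq> carrier M"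
    using Cons.prems by (auto simp: p)
  have "tensor_eq R M (k + l) (ftensor_mult R [(a, xs)] v) (ftensor_mult R [(a, xs)] v')"
    using vv'
  proof (induction rule: tensor_eq.induct)
    case (refl u)
    then show ?case
      using a by (intro tensor_eq.refl ftensor_mult_closed) auto
  next
    case (append u u' v v')
    then show ?case
      using tensor_eq.append by fastforce
  next
    case (commute u v)
    then show ?case
      using a tensor_eq.commute[OF ftensor_mult_closed[of "[(a, xs)]" k u l] ftensor_mult_closed[of "[(a, xs)]" k v l]]
      by simp
  next
    case (zero_coeff ys)
    then show ?case
      using a by (auto intro: tensor_eq.zero_coeff)
  next
    case (add_coeff b ys c)
    then show ?case
      using a tensor_eq.add_coeff[of "a \<otimes> b" "xs @ ys" "a \<otimes> c" R M "k + l"] by (auto simp: r_distr)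
  next
    case (add_slot b ys x zs y)
    then show ?case
      using a tensor_eq.add_slot[of "a \<otimes> b" "xs @ ys" x zs y R M "k + l"] by auto
  next
    case (smult_slot b ys x zs c)
    then show ?case
      using a tensor_eq.smult_slot[of "a \<otimes> b" "xs @ ys" x zs R M "k + l" c] by (auto simp: m_assoc)
  qed (auto intro: tensor_eq.sym tensor_eq.trans)
  then show ?case
    using Cons tensor_eq.append by (fastforce simp: p)
qed

text \<open>Here the slots receive the suffix \<open>ys\<close>. Splitting \<open>v\<close> into
  single terms is additivity on the right, hence the detour through
  \<open>ftensor_mult_append_right\<close>.\<close>

lemma tensor_eq_mult_left:
  assumes "v \<in> ftensors R M l" and uu': "tensor_eq R M k u u'"
  shows "tensor_eq R M (k + l) (ftensor_mult R u v) (ftensor_mult R u' v)"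
  using assms(1)
proof (induction v)
  case Nil
  then show ?case
    by (auto intro: tensor_eq.refl)
next
  case (Cons p v)
  obtain b ys where p: "p = (b, ys)"
    by (cases p)
  have b: "b \<in> carrier R" "length ys = l" "set ys \<subseteq> carrier M" and v: "v \<in> ftensors R M l"
    using Cons.prems by (auto simp: p)
  have 1: "tensor_eq R M (k + l) (ftensor_mult R u [(b, ys)]) (ftensor_mult R u' [(b, ys)])"
    using uu'
  proof (induction rule: tensor_eq.induct)
    case (refl u)
    then show ?case
      using b by (intro tensor_eq.refl ftensor_mult_closed) auto
  next
    case (append u u' v v')
    then show ?case
      using tensor_eq.append by fastforce
  next
    case (commute u v)
    then show ?case
      using b tensor_eq.commute[OF ftensor_mult_closed[of u k "[(b, ys)]" l] ftensor_mult_closed[of v k "[(b, ys)]" l]]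
      by simp
  next
    case (zero_coeff xs)
    then show ?case
      using b by (auto intro: tensor_eq.zero_coeff)
  next
    case (add_coeff a xs c)
    then show ?case
      using b tensor_eq.add_coeff[of "a \<otimes> b" "xs @ ys" "c \<otimes> b" R M "k + l"] by (auto simp: l_distr)
  next
    case (add_slot a xs x zs y)
    then show ?case
      using b tensor_eq.add_slot[of "a \<otimes> b" xs x "zs @ ys" y R M "k + l"] by auto
  next
    case (smult_slot a xs x zs c)
    \<comment> \<open>Commutativity of the ring is essential: the scalar \<open>c\<close> leaves its
      slot after \<open>b\<close> has been multiplied in on one side, and before on the
      other.\<close>
    then have "a \<otimes> b \<otimes> c = a \<otimes> c \<otimes> b"
      using b by (simp add: m_assoc m_comm[of b c])
    with smult_slot show ?case
      using b tensor_eq.smult_slot[of "a \<otimes> b" xs x "zs @ ys" R M "k + l" c] by auto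
  qed (auto intro: tensor_eq.sym tensor_eq.trans)
  have uft: "u \<in> ftensors R M k" "u' \<in> ftensors R M k"
    using tensor_eq_ftensors[OF uu'] by auto
  have "tensor_eq R M (k + l) (ftensor_mult R u ([p] @ v)) (ftensor_mult R u [p] @ ftensor_mult R u v)"
    using Cons.prems uft by (intro ftensor_mult_append_right) (auto simp: p)
  also have "tensor_eq R M (k + l) \<dots> (ftensor_mult R u' [p] @ ftensor_mult R u' v)"
    using 1 Cons.IH[OF v] by (intro tensor_eq.append) (simp_all add: p)
  also (tensor_eq.trans) have "tensor_eq R M (k + l) \<dots> (ftensor_mult R u' ([p] @ v))"
    using Cons.prems uft by (intro tensor_eq.sym[OF ftensor_mult_append_right]) (auto simp: p)
  finally (tensor_eq.trans) show ?case
    by simp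
qed

text \<open>Independence of representatives, changing the left factor and then the right
  one.\<close>

lemma tensor_mult_class:
  assumes "u \<in> ftensors R M k" "v \<in> ftensors R M l"
  shows "tensor_mult R M k l (tensor_class R M k u) (tensor_class R M l v) =
    tensor_class R M (k + l) (ftensor_mult R u v)"
  unfolding tensor_mult_def
proof (rule UN_const_eq)
  fix u' v' assume "u' \<in> tensor_class R M k u" "v' \<in> tensor_class R M l v"
  then have u': "tensor_eq R M k u' u" and v': "tensor_eq R M l v' v"
    by (auto simp: tensor_class_def intro: tensor_eq.sym)
  have "tensor_eq R M (k + l) (ftensor_mult R u' v') (ftensor_mult R u v')"
    using u' v' tensor_eq_ftensors by (blast intro: tensor_eq_mult_left)
  also have "tensor_eq R M (k + l) \<dots> (ftensor_mult R u v)"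
    using assms v' by (blast intro: tensor_eq_mult_right)
  finally (tensor_eq.trans)
  show "tensor_class R M (k + l) (ftensor_mult R u' v') = tensor_class R M (k + l) (ftensor_mult R u v)"
    by (rule tensor_class_eqI)
qed (use assms in \<open>auto intro: tensor_class_self\<close>)

lemma ftensor_mult_smult_left:
  assumes "a \<in> carrier R" "v \<in> ftensors R M l"
  shows "u \<in> ftensors R M k \<Longrightarrow>
    ftensor_mult R (ftensor_smult R a u) v = ftensor_smult R a (ftensor_mult R u v)"
proof (induction u)
  case (Cons p u)
  then show ?case
    using assms by (cases p) (auto simp: ftensor_smult_def ftensors_def m_assoc)
qed simp

lemma ftensor_mult_smult_right:
  assumes "a \<in> carrier R" "v \<in> ftensors R M l"
  shows "u \<in> ftensors R M k \<Longrightarrow>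
    ftensor_mult R u (ftensor_smult R a v) = ftensor_smult R a (ftensor_mult R u v)"
proof (induction u)
  case (Cons p u)
  then show ?case
    using assms by (cases p) (auto simp: ftensor_smult_def ftensors_def m_lcomm)
qed simp

lemma tensor_mult_zero_left:
  assumes "d \<in> carrier (tensor_power R M l)"
  shows "tensor_mult R M k l \<zero>\<^bsub>tensor_power R M k\<^esub> d = \<zero>\<^bsub>tensor_power R M (k + l)\<^esub>"
  using assms by (elim tensor_power_elem) (simp add: tensor_power_zero tensor_mult_class)

lemma tensor_mult_zero_right:
  assumes "c \<in> carrier (tensor_power R M k)"
  shows "tensor_mult R M k l c \<zero>\<^bsub>tensor_power R M l\<^esub> = \<zero>\<^bsub>tensor_power R M (k + l)\<^esub>"
  using assms by (elim tensor_power_elem) (simp add: tensor_power_zero tensor_mult_class)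

lemma tensor_mult_add_left:
  assumes "c \<in> carrier (tensor_power R M k)" "c' \<in> carrier (tensor_power R M k)"
    and "d \<in> carrier (tensor_power R M l)"
  shows "tensor_mult R M k l (c \<oplus>\<^bsub>tensor_power R M k\<^esub> c') d =
    tensor_mult R M k l c d \<oplus>\<^bsub>tensor_power R M (k + l)\<^esub> tensor_mult R M k l c' d"
  using assms
  by (elim tensor_power_elem) (simp add: tensor_power_add tensor_mult_class ftensor_mult_closed)

lemma tensor_mult_add_right:
  assumes "c \<in> carrier (tensor_power R M k)"
    and "d \<in> carrier (tensor_power R M l)" "d' \<in> carrier (tensor_power R M l)"
  shows "tensor_mult R M k l c (d \<oplus>\<^bsub>tensor_power R M l\<^esub> d') =
    tensor_mult R M k l c d \<oplus>\<^bsub>tensor_power R M (k + l)\<^esub> tensor_mult R M k l c d'"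
proof -
  obtain u v v' where ft: "u \<in> ftensors R M k" "v \<in> ftensors R M l" "v' \<in> ftensors R M l"
    and eq: "c = tensor_class R M k u" "d = tensor_class R M l v" "d' = tensor_class R M l v'"
    using assms by (elim tensor_power_elem)
  show ?thesis
    using tensor_class_eqI[OF ftensor_mult_append_right[OF ft(2,3,1)]] ft
    by (simp add: eq tensor_power_add tensor_mult_class ftensor_mult_closed)
qed

lemma tensor_mult_smult:
  assumes "a \<in> carrier R"
    and "c \<in> carrier (tensor_power R M k)" and "d \<in> carrier (tensor_power R M l)"
  shows tensor_mult_smult_left: "tensor_mult R M k l (a \<odot>\<^bsub>tensor_power R M k\<^esub> c) d =
      a \<odot>\<^bsub>tensor_power R M (k + l)\<^esub> tensor_mult R M k l c d"
    and tensor_mult_smult_right: "tensor_mult R M k l c (a \<odot>\<^bsub>tensor_power R M l\<^esub> d) =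
      a \<odot>\<^bsub>tensor_power R M (k + l)\<^esub> tensor_mult R M k l c d"
proof -
  obtain u v where ft: "u \<in> ftensors R M k" "v \<in> ftensors R M l"
    and eq: "c = tensor_class R M k u" "d = tensor_class R M l v"
    using assms by (elim tensor_power_elem)
  show "tensor_mult R M k l (a \<odot>\<^bsub>tensor_power R M k\<^esub> c) d =
      a \<odot>\<^bsub>tensor_power R M (k + l)\<^esub> tensor_mult R M k l c d"
    "tensor_mult R M k l c (a \<odot>\<^bsub>tensor_power R M l\<^esub> d) =
      a \<odot>\<^bsub>tensor_power R M (k + l)\<^esub> tensor_mult R M k l c d"
    using assms(1) ft
    by (simp_all add: eq tensor_power_smult tensor_mult_class ftensor_mult_closed
        ftensor_mult_smult_left[OF _ ft(2,1)] ftensor_mult_smult_right[OF _ ft(2,1)])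
qed

end

section \<open>Global sections of powers of a sheaf of modules\<close>

context module_sheaf
begin

lemma base_module_stalk: "x \<in> topspace (utop S) \<Longrightarrow> base_module (stalk S x) (mstalk S L x)"
  unfolding base_module_def by (rule mstalk_module)

lemma power_stalk_module: "x \<in> topspace (utop S) \<Longrightarrow> module (stalk S x) (power_stalk S L k x)"
  unfolding power_stalk_def by (rule base_module.tensor_power_module[OF base_module_stalk])

text \<open>The list of germs underlying \<open>ftensor_germ\<close>, before passing to the class.
  On lists, compatibility with products, scalars and restriction is a plain equality provable by
  induction.\<close>

definition ftensor_stalk :: "'x \<Rightarrow> 'x set \<Rightarrow> ('r, 'm) ftensor \<Rightarrow> (('x set \<times> 'r) set, ('x set \<times> 'm) set) ftensor" where
  "ftensor_stalk x U w = map (\<lambda>(a, ss). (rgerm S x U a, map (mgerm S L x U) ss)) w"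

definition ftensor_res :: "'x set \<Rightarrow> 'x set \<Rightarrow> ('r, 'm) ftensor \<Rightarrow> ('r, 'm) ftensor" where
  "ftensor_res U V w = map (\<lambda>(a, ss). (res S U V a, map (mres L U V) ss)) w"

lemma ftensor_stalk_simps [simp]:
  "ftensor_stalk x U [] = []"
  "ftensor_stalk x U ((a, ss) # w) = (rgerm S x U a, map (mgerm S L x U) ss) # ftensor_stalk x U w"
  "ftensor_stalk x U (v @ w) = ftensor_stalk x U v @ ftensor_stalk x U w"
  by (simp_all add: ftensor_stalk_def)

lemma ftensor_res_simps [simp]:
  "ftensor_res U V [] = []"
  "ftensor_res U V ((a, ss) # w) = (res S U V a, map (mres L U V) ss) # ftensor_res U V w"
  by (simp_all add: ftensor_res_def)

lemma ftensor_germ_class: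
  "ftensor_germ S L k x U w = tensor_class (stalk S x) (mstalk S L x) k (ftensor_stalk x U w)"
  by (simp add: ftensor_germ_def ftensor_stalk_def)

lemma ftensor_stalk_closed:
  "openin (utop S) U \<Longrightarrow> x \<in> U \<Longrightarrow> w \<in> ftensors (sec S U) (msec L U) k \<Longrightarrow>
    ftensor_stalk x U w \<in> ftensors (stalk S x) (mstalk S L x) k"
  by (induction w) (auto simp: rgerm_closed intro!: mgerm_closed)

lemma ftensor_germ_closed:
  "openin (utop S) U \<Longrightarrow> x \<in> U \<Longrightarrow> w \<in> ftensors (sec S U) (msec L U) k \<Longrightarrow>
    ftensor_germ S L k x U w \<in> carrier (power_stalk S L k x)"
  by (simp add: ftensor_germ_class power_stalk_def tensor_class_closed ftensor_stalk_closed)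

lemma ftensor_res_closed:
  "openin (utop S) U \<Longrightarrow> openin (utop S) V \<Longrightarrow> V \<subseteq> U \<Longrightarrow> w \<in> ftensors (sec S U) (msec L U) k \<Longrightarrow>
    ftensor_res U V w \<in> ftensors (sec S V) (msec L V) k"
  by (induction w) (auto simp: O.res_closed intro!: L.res_closed)

lemma ftensor_germ_res:
  assumes "openin (utop S) U" "openin (utop S) V" "x \<in> V" "V \<subseteq> U"
  shows "w \<in> ftensors (sec S U) (msec L U) k \<Longrightarrow>
    ftensor_germ S L k x V (ftensor_res U V w) = ftensor_germ S L k x U w"
proof -
  assume "w \<in> ftensors (sec S U) (msec L U) k"
  then have "ftensor_stalk x V (ftensor_res U V w) = ftensor_stalk x U w"
    using assms by (induction w) (auto simp: rgerm_res mgerm_res subset_code(1))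
  then show ?thesis
    by (simp add: ftensor_germ_class)
qed

lemma ftensor_germ_append:
  assumes "openin (utop S) U" "x \<in> U"
    and "u \<in> ftensors (sec S U) (msec L U) k" "v \<in> ftensors (sec S U) (msec L U) k"
  shows "ftensor_germ S L k x U (u @ v) =
    ftensor_germ S L k x U u \<oplus>\<^bsub>power_stalk S L k x\<^esub> ftensor_germ S L k x U v"
  using assms tensor_power_add[OF ftensor_stalk_closed[OF assms(1,2,3)] ftensor_stalk_closed[OF assms(1,2,4)]]
  by (simp add: ftensor_germ_class power_stalk_def)

lemma ftensor_germ_smult:
  assumes U: "openin (utop S) U" "x \<in> U" and a: "a \<in> carrier (sec S U)"
    and u: "u \<in> ftensors (sec S U) (msec L U) k"
  shows "ftensor_germ S L k x U (ftensor_smult (sec S U) a u) =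
    rgerm S x U a \<odot>\<^bsub>power_stalk S L k x\<^esub> ftensor_germ S L k x U u"
proof -
  interpret M: base_module "stalk S x" "mstalk S L x"
    using U openin_subset by (blast intro: base_module_stalk)
  have "ftensor_stalk x U (ftensor_smult (sec S U) a u) =
      ftensor_smult (stalk S x) (rgerm S x U a) (ftensor_stalk x U u)"
    using u U a by (induction u) (auto simp: stalk_mult)
  then show ?thesis
    using M.tensor_power_smult[OF rgerm_closed[OF U a] ftensor_stalk_closed[OF U u]]
    by (simp add: ftensor_germ_class power_stalk_def)
qed

text \<open>Germs respect the ring product, and slots are merely concatenated, so the two lists of
  germs already coincide.\<close>

lemma ftensor_germ_mult:
  assumes U: "openin (utop S) U" "x \<in> U"
    and u: "u \<in> ftensors (sec S U) (msec L U) k" and v: "v \<in> ftensors (sec S U) (msec L U) l"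
  shows "ftensor_germ S L (k + l) x U (ftensor_mult (sec S U) u v) =
    tensor_mult (stalk S x) (mstalk S L x) k l (ftensor_germ S L k x U u) (ftensor_germ S L l x U v)"
proof -
  interpret M: base_module "stalk S x" "mstalk S L x"
    using U openin_subset by (blast intro: base_module_stalk)
  have "ftensor_stalk x U (ftensor_mult (sec S U) u v) =
      ftensor_mult (stalk S x) (ftensor_stalk x U u) (ftensor_stalk x U v)"
    using u
  proof (induction u)
    case (Cons p u)
    then have "ftensor_stalk x U (ftensor_mult (sec S U) [p] v) =
        ftensor_mult (stalk S x) (ftensor_stalk x U [p]) (ftensor_stalk x U v)"
      using U v by (cases p) (auto simp: ftensor_stalk_def ftensors_def stalk_mult)
    with Cons show ?case
      by (cases p) simp
  qed simp
  then show ?thesis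
    using M.tensor_mult_class[OF ftensor_stalk_closed[OF U u] ftensor_stalk_closed[OF U v]]
    by (simp add: ftensor_germ_class)
qed

lemma power_sections_ext: "s \<in> power_sections S L k U \<Longrightarrow> s \<in> extensional U"
  by (simp add: power_sections_def)

lemma power_sections_local:
  assumes "s \<in> power_sections S L k U" "x \<in> U" "openin (utop S) Y" "x \<in> Y"
  obtains V w where "openin (utop S) V" "x \<in> V" "V \<subseteq> U \<inter> Y" "w \<in> ftensors (sec S V) (msec L V) k"
    "\<forall>y\<in>V. s y = ftensor_germ S L k y V w"
proof -
  obtain V w where V: "openin (utop S) V" "x \<in> V" "V \<subseteq> U" "w \<in> ftensors (sec S V) (msec L V) k"
    "\<forall>y\<in>V. s y = ftensor_germ S L k y V w"
    using assms(1,2) by (auto simp: power_sections_def)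
  have o: "openin (utop S) (V \<inter> Y)"
    using V assms by (simp add: openin_Int)
  have "s y = ftensor_germ S L k y (V \<inter> Y) (ftensor_res V (V \<inter> Y) w)" if "y \<in> V \<inter> Y" for y
    using ftensor_germ_res[OF V(1) o that _ V(4)] V(5) that by simp
  then show ?thesis
    by (intro that[OF o _ _ ftensor_res_closed[OF V(1) o _ V(4)]]) (use V assms in auto)
qed

text \<open>The neighbourhood for \<open>t\<close> is chosen inside the one for \<open>s\<close>,
  and the tensor representing \<open>s\<close> is restricted to it.\<close>

lemma power_sections_local2:
  assumes "s \<in> power_sections S L k U" "t \<in> power_sections S L l U" "x \<in> U" "openin (utop S) Y" "x \<in> Y"
  obtains V u v where "openin (utop S) V" "x \<in> V" "V \<subseteq> U \<inter> Y"
    "u \<in> ftensors (sec S V) (msec L V) k" "v \<in> ftensors (sec S V) (msec L V) l"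
    "\<forall>y\<in>V. s y = ftensor_germ S L k y V u"
    "\<forall>y\<in>V. t y = ftensor_germ S L l y V v"
proof -
  obtain V u where V: "openin (utop S) V" "x \<in> V" "V \<subseteq> U \<inter> Y" "u \<in> ftensors (sec S V) (msec L V) k"
    "\<forall>y\<in>V. s y = ftensor_germ S L k y V u"
    using power_sections_local[OF assms(1,3,4,5)] .
  obtain W v where W: "openin (utop S) W" "x \<in> W" "W \<subseteq> U \<inter> V" "v \<in> ftensors (sec S W) (msec L W) l"
    "\<forall>y\<in>W. t y = ftensor_germ S L l y W v"
    using power_sections_local[OF assms(2,3) V(1,2)] .
  have WV: "W \<subseteq> V"
    using W by blast
  have "s y = ftensor_germ S L k y W (ftensor_res V W u)" if "y \<in> W" for y
    using ftensor_germ_res[OF V(1) W(1) that WV V(4)] V(5) that WV by auto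
  then show ?thesis
    by (intro that[OF W(1,2) _ ftensor_res_closed[OF V(1) W(1) WV V(4)] W(4) _ W(5)])
      (use WV V(3) in auto)
qed

lemma power_sectionsI:
  assumes "s \<in> extensional U"
    and "\<And>x. x \<in> U \<Longrightarrow> \<exists>V w. openin (utop S) V \<and> x \<in> V \<and> V \<subseteq> U \<and>
      w \<in> ftensors (sec S V) (msec L V) k \<and> (\<forall>y\<in>V. s y = ftensor_germ S L k y V w)"
  shows "s \<in> power_sections S L k U"
  using assms by (simp add: power_sections_def)

lemma power_sections_stalk:
  assumes "s \<in> power_sections S L k U" "x \<in> U" "openin (utop S) U"
  shows "s x \<in> carrier (power_stalk S L k x)"
  by (rule power_sections_local[OF assms(1,2,3,2)]) (simp add: ftensor_germ_closed)

text \<open>Where both factors are given by tensors of sections, the product is given by the product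
  of those tensors.\<close>

lemma sec_mult_closed:
  assumes "s \<in> power_sections S L k (topspace (utop S))" "t \<in> power_sections S L l (topspace (utop S))"
  shows "sec_mult S L k l s t \<in> power_sections S L (k + l) (topspace (utop S))"
proof (rule power_sectionsI)
  fix x assume x: "x \<in> topspace (utop S)"
  obtain V u v where V: "openin (utop S) V" "x \<in> V" "V \<subseteq> topspace (utop S) \<inter> topspace (utop S)"
    and u: "u \<in> ftensors (sec S V) (msec L V) k" and v: "v \<in> ftensors (sec S V) (msec L V) l"
    and eq: "\<forall>y\<in>V. s y = ftensor_germ S L k y V u" "\<forall>y\<in>V. t y = ftensor_germ S L l y V v"
    using power_sections_local2[OF assms x openin_X x] .
  interpret M: base_module "sec S V" "msec L V"
    unfolding base_module_def using V(1) by (rule msec_module)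
  have "\<forall>y\<in>V. sec_mult S L k l s t y = ftensor_germ S L (k + l) y V (ftensor_mult (sec S V) u v)"
    using V u v by (auto simp: sec_mult_def eq ftensor_germ_mult)
  then show "\<exists>V w. openin (utop S) V \<and> x \<in> V \<and> V \<subseteq> topspace (utop S) \<and>
      w \<in> ftensors (sec S V) (msec L V) (k + l) \<and>
      (\<forall>y\<in>V. sec_mult S L k l s t y = ftensor_germ S L (k + l) y V w)"
    using V M.ftensor_mult_closed[OF u v] by blast
qed (simp add: sec_mult_def)

end

lemma restrict_eq_iff: "(\<lambda>x\<in>A. f x) = (\<lambda>x\<in>A. g x) \<longleftrightarrow> (\<forall>x\<in>A. f x = g x)"
  by (metis restrict_apply' restrict_ext)

section \<open>The vector space of global sections and its product\<close>

locale kspace_sheaf = module_sheaf S L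
  for S :: "('x, 'r, 'k::field) kspace" and L :: "('x, 'r, 'm) modsheaf" +
  assumes str_hom: "str S \<in> ring_hom ring_of_type_algebra (sec S (topspace (utop S)))"
begin

text \<open>The image of a field element in the stalk. By the lemmas that follow it is a ring
  homomorphism at each point, through which modules over the stalk become vector spaces.\<close>

definition scalar :: "'x \<Rightarrow> 'k \<Rightarrow> ('x set \<times> 'r) set" where
  "scalar x a = rgerm S x (topspace (utop S)) (str S a)"

lemma str_closed: "str S a \<in> carrier (sec S (topspace (utop S)))"
  using ring_hom_closed[OF str_hom] by simp

lemma scalar_closed: "x \<in> topspace (utop S) \<Longrightarrow> scalar x a \<in> carrier (stalk S x)"
  by (simp add: scalar_def rgerm_closed str_closed)

lemma scalar_add: "x \<in> topspace (utop S) \<Longrightarrow> scalar x (a + b) = scalar x a \<oplus>\<^bsub>stalk S x\<^esub> scalar x b"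
  using ring_hom_add[OF str_hom, of a b] by (simp add: scalar_def stalk_add str_closed)

lemma scalar_mult: "x \<in> topspace (utop S) \<Longrightarrow> scalar x (a * b) = scalar x a \<otimes>\<^bsub>stalk S x\<^esub> scalar x b"
  using ring_hom_mult[OF str_hom, of a b] by (simp add: scalar_def stalk_mult str_closed)

lemma scalar_one: "x \<in> topspace (utop S) \<Longrightarrow> scalar x 1 = \<one>\<^bsub>stalk S x\<^esub>"
  using ring_hom_one[OF str_hom] by (simp add: scalar_def stalk_one[of "topspace (utop S)"])

lemma scalar_zero: "x \<in> topspace (utop S) \<Longrightarrow> scalar x 0 = \<zero>\<^bsub>stalk S x\<^esub>"
  using ring_hom_zero[OF str_hom ring_from_type_algebra cring.axioms(1)[OF sec_cring[OF openin_X]]]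
  by (simp add: scalar_def stalk_zero[of "topspace (utop S)"])

lemma H0_simps:
  "carrier (H0 S L k) = power_sections S L k (topspace (utop S))"
  "\<zero>\<^bsub>H0 S L k\<^esub> = (\<lambda>x\<in>topspace (utop S). \<zero>\<^bsub>power_stalk S L k x\<^esub>)"
  "s \<oplus>\<^bsub>H0 S L k\<^esub> t = (\<lambda>x\<in>topspace (utop S). s x \<oplus>\<^bsub>power_stalk S L k x\<^esub> t x)"
  "a \<odot>\<^bsub>H0 S L k\<^esub> s = (\<lambda>x\<in>topspace (utop S). scalar x a \<odot>\<^bsub>power_stalk S L k x\<^esub> s x)"
  by (simp_all add: H0_def scalar_def)

lemma H0_ext:
  assumes "s \<in> carrier (H0 S L k)" "t \<in> carrier (H0 S L k)" "\<And>x. x \<in> topspace (utop S) \<Longrightarrow> s x = t x"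
  shows "s = t"
  using assms by (intro extensionalityI[of _ "topspace (utop S)"]) (auto simp: H0_simps power_sections_ext)

lemma H0_stalk:
  "s \<in> carrier (H0 S L k) \<Longrightarrow> x \<in> topspace (utop S) \<Longrightarrow> s x \<in> carrier (power_stalk S L k x)"
  using power_sections_stalk openin_X by (simp add: H0_simps)

lemma H0_zero_closed: "\<zero>\<^bsub>H0 S L k\<^esub> \<in> carrier (H0 S L k)"
  unfolding H0_simps
proof (rule power_sectionsI)
  fix x assume x: "x \<in> topspace (utop S)"
  show "\<exists>V w. openin (utop S) V \<and> x \<in> V \<and> V \<subseteq> topspace (utop S) \<and>
      w \<in> ftensors (sec S V) (msec L V) k \<and>
      (\<forall>y\<in>V. (\<lambda>x\<in>topspace (utop S). \<zero>\<^bsub>power_stalk S L k x\<^esub>) y = ftensor_germ S L k y V w)"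
    \<comment> \<open>The empty formal tensor over the whole space represents zero.\<close>
    using x by (intro exI[of _ "topspace (utop S)"] exI[of _ "[]"])
      (simp add: ftensor_germ_def power_stalk_def tensor_power_zero)
qed simp

lemma H0_add_closed:
  assumes "s \<in> carrier (H0 S L k)" "t \<in> carrier (H0 S L k)"
  shows "s \<oplus>\<^bsub>H0 S L k\<^esub> t \<in> carrier (H0 S L k)"
  unfolding H0_simps
proof (rule power_sectionsI)
  fix x assume x: "x \<in> topspace (utop S)"
  obtain V u v where V: "openin (utop S) V" "x \<in> V" "V \<subseteq> topspace (utop S) \<inter> topspace (utop S)"
    and u: "u \<in> ftensors (sec S V) (msec L V) k" and v: "v \<in> ftensors (sec S V) (msec L V) k"
    and eq: "\<forall>y\<in>V. s y = ftensor_germ S L k y V u" "\<forall>y\<in>V. t y = ftensor_germ S L k y V v"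
    using power_sections_local2[OF assms[unfolded H0_simps] x openin_X x] .
  have "\<forall>y\<in>V. (\<lambda>x\<in>topspace (utop S). s x \<oplus>\<^bsub>power_stalk S L k x\<^esub> t x) y = ftensor_germ S L k y V (u @ v)"
    using V u v by (auto simp: eq ftensor_germ_append)
  then show "\<exists>V w. openin (utop S) V \<and> x \<in> V \<and> V \<subseteq> topspace (utop S) \<and>
      w \<in> ftensors (sec S V) (msec L V) k \<and>
      (\<forall>y\<in>V. (\<lambda>x\<in>topspace (utop S). s x \<oplus>\<^bsub>power_stalk S L k x\<^esub> t x) y = ftensor_germ S L k y V w)"
    using V u v by (intro exI[of _ V] exI[of _ "u @ v"]) simp
qed simp

lemma H0_smult_closed:
  assumes "s \<in> carrier (H0 S L k)"
  shows "a \<odot>\<^bsub>H0 S L k\<^esub> s \<in> carrier (H0 S L k)"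
  unfolding H0_simps
proof (rule power_sectionsI)
  fix x assume x: "x \<in> topspace (utop S)"
  obtain V u where V: "openin (utop S) V" "x \<in> V" "V \<subseteq> topspace (utop S) \<inter> topspace (utop S)"
    and u: "u \<in> ftensors (sec S V) (msec L V) k"
    and eq: "\<forall>y\<in>V. s y = ftensor_germ S L k y V u"
    using power_sections_local[OF assms[unfolded H0_simps] x openin_X x] .
  interpret M: base_module "sec S V" "msec L V"
    unfolding base_module_def using V(1) by (rule msec_module)
  \<comment> \<open>\<open>scalar\<close> is the germ of a global constant, while the representative
    of \<open>s\<close> lives on \<open>V\<close>; restricting the constant brings both to
    \<open>V\<close>.\<close>
  define b where "b = res S (topspace (utop S)) V (str S a)"
  have b: "b \<in> carrier (sec S V)"
    using V by (simp add: b_def O.res_closed str_closed)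
  have "scalar y a = rgerm S y V b" if "y \<in> V" for y
    using that V by (simp add: scalar_def b_def rgerm_res str_closed)
  then have "\<forall>y\<in>V. (\<lambda>x\<in>topspace (utop S). scalar x a \<odot>\<^bsub>power_stalk S L k x\<^esub> s x) y =
      ftensor_germ S L k y V (ftensor_smult (sec S V) b u)"
    using V u b by (auto simp: eq ftensor_germ_smult)
  then show "\<exists>V w. openin (utop S) V \<and> x \<in> V \<and> V \<subseteq> topspace (utop S) \<and>
      w \<in> ftensors (sec S V) (msec L V) k \<and>
      (\<forall>y\<in>V. (\<lambda>x\<in>topspace (utop S). scalar x a \<odot>\<^bsub>power_stalk S L k x\<^esub> s x) y = ftensor_germ S L k y V w)"
    using V u b by (intro exI[of _ V] exI[of _ "ftensor_smult (sec S V) b u"]) simp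
qed simp

text \<open>Each law is checked at every point in the module over the stalk. Negatives are taken as
  multiples by -1, so that their closure is that of scalar multiplication.\<close>

lemma H0_module: "module ring_of_type_algebra (H0 S L k)"
proof -
  let ?H = "H0 S L k" and ?P = "power_stalk S L k"
  note closed = H0_zero_closed H0_add_closed H0_smult_closed
  have add_assoc: "s \<oplus>\<^bsub>?H\<^esub> t \<oplus>\<^bsub>?H\<^esub> u = s \<oplus>\<^bsub>?H\<^esub> (t \<oplus>\<^bsub>?H\<^esub> u)"
    and add_comm: "s \<oplus>\<^bsub>?H\<^esub> t = t \<oplus>\<^bsub>?H\<^esub> s"
    and zero: "\<zero>\<^bsub>?H\<^esub> \<oplus>\<^bsub>?H\<^esub> s = s"
    and neg: "((- 1) \<odot>\<^bsub>?H\<^esub> s) \<oplus>\<^bsub>?H\<^esub> s = \<zero>\<^bsub>?H\<^esub>"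
    and l_distr: "(a + b) \<odot>\<^bsub>?H\<^esub> s = a \<odot>\<^bsub>?H\<^esub> s \<oplus>\<^bsub>?H\<^esub> b \<odot>\<^bsub>?H\<^esub> s"
    and r_distr: "a \<odot>\<^bsub>?H\<^esub> (s \<oplus>\<^bsub>?H\<^esub> t) = a \<odot>\<^bsub>?H\<^esub> s \<oplus>\<^bsub>?H\<^esub> a \<odot>\<^bsub>?H\<^esub> t"
    and assoc: "(a * b) \<odot>\<^bsub>?H\<^esub> s = a \<odot>\<^bsub>?H\<^esub> (b \<odot>\<^bsub>?H\<^esub> s)"
    and one: "1 \<odot>\<^bsub>?H\<^esub> s = s"
    if stu: "s \<in> carrier ?H" "t \<in> carrier ?H" "u \<in> carrier ?H" for s t u a b
  proof -
    have pointwise: "module (stalk S x) (?P x)" "s x \<in> carrier (?P x)" "t x \<in> carrier (?P x)"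
      "u x \<in> carrier (?P x)" "scalar x c \<in> carrier (stalk S x)"
      if "x \<in> topspace (utop S)" for x c
      using that stu by (auto intro: power_stalk_module H0_stalk scalar_closed)
    {
      fix x assume x: "x \<in> topspace (utop S)"
      interpret P: module "stalk S x" "?P x"
        by (rule pointwise[OF x])
      note mem = pointwise(2-)[OF x]
      \<comment> \<open>The sum is the multiple by -1 + 1 = 0, once \<open>s x\<close> is written as
        its multiple by 1.\<close>
      have "scalar x (-1) \<odot>\<^bsub>?P x\<^esub> s x \<oplus>\<^bsub>?P x\<^esub> s x =
          scalar x (-1) \<odot>\<^bsub>?P x\<^esub> s x \<oplus>\<^bsub>?P x\<^esub> scalar x 1 \<odot>\<^bsub>?P x\<^esub> s x"
        using mem by (simp add: scalar_one[OF x])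
      also have "\<dots> = scalar x (-1 + 1) \<odot>\<^bsub>?P x\<^esub> s x"
        using mem by (simp only: scalar_add[OF x] P.smult_l_distr)
      finally have "scalar x (-1) \<odot>\<^bsub>?P x\<^esub> s x \<oplus>\<^bsub>?P x\<^esub> s x = \<zero>\<^bsub>?P x\<^esub>"
        using mem by (simp add: scalar_zero[OF x])
      then have "((- 1) \<odot>\<^bsub>?H\<^esub> s \<oplus>\<^bsub>?H\<^esub> s) x = \<zero>\<^bsub>?H\<^esub> x"
        and "(s \<oplus>\<^bsub>?H\<^esub> t \<oplus>\<^bsub>?H\<^esub> u) x = (s \<oplus>\<^bsub>?H\<^esub> (t \<oplus>\<^bsub>?H\<^esub> u)) x"
        and "(s \<oplus>\<^bsub>?H\<^esub> t) x = (t \<oplus>\<^bsub>?H\<^esub> s) x"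
        and "(\<zero>\<^bsub>?H\<^esub> \<oplus>\<^bsub>?H\<^esub> s) x = s x"
        and "((a + b) \<odot>\<^bsub>?H\<^esub> s) x = (a \<odot>\<^bsub>?H\<^esub> s \<oplus>\<^bsub>?H\<^esub> b \<odot>\<^bsub>?H\<^esub> s) x"
        and "(a \<odot>\<^bsub>?H\<^esub> (s \<oplus>\<^bsub>?H\<^esub> t)) x = (a \<odot>\<^bsub>?H\<^esub> s \<oplus>\<^bsub>?H\<^esub> a \<odot>\<^bsub>?H\<^esub> t) x"
        and "((a * b) \<odot>\<^bsub>?H\<^esub> s) x = (a \<odot>\<^bsub>?H\<^esub> (b \<odot>\<^bsub>?H\<^esub> s)) x"
        and "(1 \<odot>\<^bsub>?H\<^esub> s) x = s x"
        using x mem by (simp_all add: H0_simps P.M.a_ac scalar_add[OF x] scalar_mult[OF x] scalar_one[OF x]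
            P.smult_l_distr P.smult_r_distr P.smult_assoc1)
    }
    note pw = this
    show "s \<oplus>\<^bsub>?H\<^esub> t \<oplus>\<^bsub>?H\<^esub> u = s \<oplus>\<^bsub>?H\<^esub> (t \<oplus>\<^bsub>?H\<^esub> u)" "s \<oplus>\<^bsub>?H\<^esub> t = t \<oplus>\<^bsub>?H\<^esub> s"
      "\<zero>\<^bsub>?H\<^esub> \<oplus>\<^bsub>?H\<^esub> s = s" "((- 1) \<odot>\<^bsub>?H\<^esub> s) \<oplus>\<^bsub>?H\<^esub> s = \<zero>\<^bsub>?H\<^esub>"
      "(a + b) \<odot>\<^bsub>?H\<^esub> s = a \<odot>\<^bsub>?H\<^esub> s \<oplus>\<^bsub>?H\<^esub> b \<odot>\<^bsub>?H\<^esub> s"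
      "a \<odot>\<^bsub>?H\<^esub> (s \<oplus>\<^bsub>?H\<^esub> t) = a \<odot>\<^bsub>?H\<^esub> s \<oplus>\<^bsub>?H\<^esub> a \<odot>\<^bsub>?H\<^esub> t"
      "(a * b) \<odot>\<^bsub>?H\<^esub> s = a \<odot>\<^bsub>?H\<^esub> (b \<odot>\<^bsub>?H\<^esub> s)" "1 \<odot>\<^bsub>?H\<^esub> s = s"
      by (rule H0_ext[where k = k]; (intro closed stu pw; assumption))+
  qed
  have inv: "\<exists>t\<in>carrier ?H. t \<oplus>\<^bsub>?H\<^esub> s = \<zero>\<^bsub>?H\<^esub>" if "s \<in> carrier ?H" for s
    using neg[OF that that that] H0_smult_closed[OF that] by blast
  show ?thesis
  proof (rule moduleI)
    show "abelian_group ?H"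
      by (intro abelian_groupI) (assumption | rule closed add_assoc add_comm zero inv)+
  qed (simp_all add: closed cring_from_type_algebra l_distr r_distr assoc one)
qed

text \<open>Sections are added, scaled and multiplied point by point, so bilinearity is that of
  \<open>tensor_mult\<close> over each stalk.\<close>

lemma bilinear_pairing_sec_mult:
  "bilinear_pairing (H0 S L k) (H0 S L l) (H0 S L (k + l)) (sec_mult S L k l)"
proof -
  have vm: "vector_module (H0 S L i)" for i
    unfolding vector_module_def by (rule H0_module)
  note base = base_module_stalk
  note bilinear = base_module.tensor_mult_zero_left[OF base] base_module.tensor_mult_zero_right[OF base]
    base_module.tensor_mult_add_left[OF base] base_module.tensor_mult_add_right[OF base]
    base_module.tensor_mult_smult_left[OF base] base_module.tensor_mult_smult_right[OF base]
  note bilinear = bilinear[folded power_stalk_def]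
  show ?thesis
  proof (intro bilinear_pairing.intro bilinear_pairing_axioms.intro vm)
    fix s t s' t' a
    assume s: "s \<in> carrier (H0 S L k)" and t: "t \<in> carrier (H0 S L l)"
    show "sec_mult S L k l s t \<in> carrier (H0 S L (k + l))"
      using s t by (simp add: H0_simps sec_mult_closed)
    show "sec_mult S L k l (a \<odot>\<^bsub>H0 S L k\<^esub> s) t = a \<odot>\<^bsub>H0 S L (k + l)\<^esub> sec_mult S L k l s t"
      "sec_mult S L k l s (a \<odot>\<^bsub>H0 S L l\<^esub> t) = a \<odot>\<^bsub>H0 S L (k + l)\<^esub> sec_mult S L k l s t"
      using H0_stalk[OF s] H0_stalk[OF t]
      by (auto simp: H0_simps sec_mult_def restrict_eq_iff bilinear scalar_closed)
  next
    fix t assume t: "t \<in> carrier (H0 S L l)"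
    show "sec_mult S L k l \<zero>\<^bsub>H0 S L k\<^esub> t = \<zero>\<^bsub>H0 S L (k + l)\<^esub>"
      using H0_stalk[OF t] by (auto simp: H0_simps sec_mult_def restrict_eq_iff bilinear)
  next
    fix s assume s: "s \<in> carrier (H0 S L k)"
    show "sec_mult S L k l s \<zero>\<^bsub>H0 S L l\<^esub> = \<zero>\<^bsub>H0 S L (k + l)\<^esub>"
      using H0_stalk[OF s] by (auto simp: H0_simps sec_mult_def restrict_eq_iff bilinear)
  next
    fix s s' t assume "s \<in> carrier (H0 S L k)" "s' \<in> carrier (H0 S L k)" "t \<in> carrier (H0 S L l)"
    then show "sec_mult S L k l (s \<oplus>\<^bsub>H0 S L k\<^esub> s') t =
        sec_mult S L k l s t \<oplus>\<^bsub>H0 S L (k + l)\<^esub> sec_mult S L k l s' t"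
      \<comment> \<open>The equation for the carrier is left out so that the premises keep the form
        in which \<open>H0_stalk\<close> is stated.\<close>
      using H0_stalk by (auto simp: H0_simps(2-) sec_mult_def restrict_eq_iff bilinear)
  next
    fix s t t' assume "s \<in> carrier (H0 S L k)" "t \<in> carrier (H0 S L l)" "t' \<in> carrier (H0 S L l)"
    then show "sec_mult S L k l s (t \<oplus>\<^bsub>H0 S L l\<^esub> t') =
        sec_mult S L k l s t \<oplus>\<^bsub>H0 S L (k + l)\<^esub> sec_mult S L k l s t'"
      using H0_stalk by (auto simp: H0_simps(2-) sec_mult_def restrict_eq_iff bilinear)
  qed
qed

end

section \<open>Geodesics between graded norms\<close>

theorem theorem2p8p1:
  fixes av :: "'k::field \<Rightarrow> real"
    and S :: "('x, 'r, 'k) kspace"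
    and L :: "('x, 'r, 'm) modsheaf"
    and \<zeta>0 \<zeta>1 :: "nat \<Rightarrow> ('x, 'r, 'm) psection \<Rightarrow> real"
    and \<zeta>t :: "real \<Rightarrow> nat \<Rightarrow> ('x, 'r, 'm) psection \<Rightarrow> real"
  assumes "complete_nonarch_abs av"
    and "projective_scheme S" and "geometrically_integral S"
    and "line_bundle S L" and "ample S L"
    and "bounded_graded_norm av S L \<zeta>0" and "bounded_graded_norm av S L \<zeta>1"
    and "\<And>t k. t \<in> {0..1} \<Longrightarrow> norm_geodesic_at av (H0 S L k) (\<zeta>0 k) (\<zeta>1 k) t (\<zeta>t t k)"
  shows "\<forall>t\<in>{0..1}. \<forall>k l. \<forall>s\<in>carrier (H0 S L k). \<forall>s'\<in>carrier (H0 S L l).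
           \<zeta>t t (k + l) (sec_mult S L k l s s') \<le> \<zeta>t t k s * \<zeta>t t l s'"
proof -
  \<comment> \<open>Projectivity supplies the ringed space and its structure map, the line bundle
    the sheaf of modules.\<close>
  interpret kspace_sheaf S L
    using assms(2,4) by unfold_locales
      (simp_all add: projective_scheme_def ringed_kspace_def line_bundle_def)
  have av: "nonarch_abs av"
    using assms(1) by (simp add: complete_nonarch_abs_def)
  have graded: "graded_norm av S L \<zeta>0" "graded_norm av S L \<zeta>1"
    using assms(6,7) by (simp_all add: bounded_graded_norm_def)
  show ?thesis
  proof (intro ballI allI)
    fix t :: real and k l s s'
    assume t: "t \<in> {0..1}" and s: "s \<in> carrier (H0 S L k)" "s' \<in> carrier (H0 S L l)"
    interpret B: bilinear_pairing "H0 S L k" "H0 S L l" "H0 S L (k + l)" "sec_mult S L k l"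
      by (rule bilinear_pairing_sec_mult)
    show "\<zeta>t t (k + l) (sec_mult S L k l s s') \<le> \<zeta>t t k s * \<zeta>t t l s'"
      \<comment> \<open>The geodesics in degrees \<open>k + l\<close>, \<open>k\<close> and
        \<open>l\<close> enter in this order; submultiplicativity of the two graded norms is the
        endpoint hypothesis.\<close>
      using graded by (intro B.norm_geodesic_at_submult[OF av t _ _ _ _ _ _ assms(8)[OF t] assms(8)[OF t] assms(8)[OF t]] s)
        (simp_all add: graded_norm_def)
  qed
qed

end
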